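(* Let $H$ be a finite group with $H \neq 1$, and let $G$ be a group containing $H \wr \mathbb{Z}$ as a subgroup. Then neither $\mathcal{D}(G)$ nor $\mathcal{U}(G)$ is flat as a (left) module over the complex group algebra $\mathbb{C}G$.
   Context: For a group $A$, $A \wr \mathbb{Z}$ denotes the (restricted) wreath product $B \rtimes \mathbb{Z}$ with base group $B = \bigoplus_{i=-\infty}^{\infty} A_i$, $A_i = A$ for all $i$, where a generator $x$ of $\mathbb{Z}$ acts by shifting: $x^i A_0 x^{-i} = A_i$. $\mathcal{N}(G)$ denotes the group von Neumann algebra of $G$, i.e. the weak operator closure of $\mathbb{C}G$ acting by left multiplication on $\ell^2(G)$ (equivalently, the bounded operators on $\ell^2(G)$ commuting with the right translation action of $G$). $\mathcal{U}(G)$ denotes the algebra of (closed, densely defined, possibly unbounded) linear operators on $\ell^2(G)$ affiliated to $\mathcal{N}(G)$, with addition and multiplication given by the closures of the sum and composition of operators; equivalently, the ring of fractions of $\mathcal{N}(G)$ with respect to all its non-zerodivisors. $\mathcal{D}(G)$ denotes the division closure of $\mathbb{C}G$ in $\mathcal{U}(G)$, i.e. the smallest subring $D$ of $\mathcal{U}(G)$ containing $\mathbb{C}G$ such that every element of $D$ that is invertible in $\mathcal{U}(G)$ has its inverse in $D$. Thus $\mathbb{C}G \subseteq \mathcal{D}(G) \subseteq \mathcal{U}(G)$. *)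

theory Defs
  imports "HOL-Algebra.Free_Abelian_Groups" "HOL-Algebra.Subrings" "HOL-Analysis.Infinite_Sum"
begin

section \<open>The wreath product of a group with the integers\<close>

text \<open>
  The base group is the restricted direct power of \<open>A\<close> indexed by the integers, and the
  \<open>n\<close>-th power of the generator \<open>x\<close> carries the copy of \<open>A\<close> at index \<open>i\<close> to the one at
  index \<open>i + n\<close>.  The pair \<open>(f, m)\<close> stands for the product of \<open>f\<close> and the \<open>m\<close>-th power of \<open>x\<close>.
\<close>

definition wreath_base :: "('a, 'm) monoid_scheme \<Rightarrow> (int \<Rightarrow> 'a) monoid" where
  "wreath_base A = sum_group UNIV (\<lambda>_. A)"

definition wreath_shift :: "int \<Rightarrow> (int \<Rightarrow> 'a) \<Rightarrow> (int \<Rightarrow> 'a)" where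
  "wreath_shift n f = (\<lambda>i. f (i - n))"

definition wreath_int :: "('a, 'm) monoid_scheme \<Rightarrow> ((int \<Rightarrow> 'a) \<times> int) monoid" where
  "wreath_int A =
     \<lparr>carrier = carrier (wreath_base A) \<times> UNIV,
      monoid.mult = (\<lambda>(f, m) (g, n). (f \<otimes>\<^bsub>wreath_base A\<^esub> wreath_shift m g, m + n)),
      one = (\<one>\<^bsub>wreath_base A\<^esub>, 0)\<rparr>"


section \<open>Modules over noncommutative rings, tensor products and flatness\<close>

locale left_module = R?: ring R + M?: abelian_group M
  for R :: "('r, 'x) ring_scheme" (structure) and M :: "('r, 'm, 'z) module_scheme" (structure) +
  assumes smult_closed:
      "\<lbrakk>a \<in> carrier R; x \<in> carrier M\<rbrakk> \<Longrightarrow> a \<odot>\<^bsub>M\<^esub> x \<in> carrier M"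
    and smult_l_distr:
      "\<lbrakk>a \<in> carrier R; b \<in> carrier R; x \<in> carrier M\<rbrakk> \<Longrightarrow>
       (a \<oplus>\<^bsub>R\<^esub> b) \<odot>\<^bsub>M\<^esub> x = a \<odot>\<^bsub>M\<^esub> x \<oplus>\<^bsub>M\<^esub> b \<odot>\<^bsub>M\<^esub> x"
    and smult_r_distr:
      "\<lbrakk>a \<in> carrier R; x \<in> carrier M; y \<in> carrier M\<rbrakk> \<Longrightarrow>
       a \<odot>\<^bsub>M\<^esub> (x \<oplus>\<^bsub>M\<^esub> y) = a \<odot>\<^bsub>M\<^esub> x \<oplus>\<^bsub>M\<^esub> a \<odot>\<^bsub>M\<^esub> y"
    and smult_assoc:
      "\<lbrakk>a \<in> carrier R; b \<in> carrier R; x \<in> carrier M\<rbrakk> \<Longrightarrow>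
       (a \<otimes>\<^bsub>R\<^esub> b) \<odot>\<^bsub>M\<^esub> x = a \<odot>\<^bsub>M\<^esub> (b \<odot>\<^bsub>M\<^esub> x)"
    and smult_one:
      "x \<in> carrier M \<Longrightarrow> \<one>\<^bsub>R\<^esub> \<odot>\<^bsub>M\<^esub> x = x"

text \<open>
  Right modules use the same record as left modules: here \<open>a \<odot>\<^bsub>M\<^esub> x\<close> is to be read as
  \<open>x\<close> multiplied by \<open>a\<close> from the right.
\<close>

locale right_module = R?: ring R + M?: abelian_group M
  for R :: "('r, 'x) ring_scheme" (structure) and M :: "('r, 'm, 'z) module_scheme" (structure) +
  assumes smult_closed:
      "\<lbrakk>a \<in> carrier R; x \<in> carrier M\<rbrakk> \<Longrightarrow> a \<odot>\<^bsub>M\<^esub> x \<in> carrier M"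
    and smult_l_distr:
      "\<lbrakk>a \<in> carrier R; b \<in> carrier R; x \<in> carrier M\<rbrakk> \<Longrightarrow>
       (a \<oplus>\<^bsub>R\<^esub> b) \<odot>\<^bsub>M\<^esub> x = a \<odot>\<^bsub>M\<^esub> x \<oplus>\<^bsub>M\<^esub> b \<odot>\<^bsub>M\<^esub> x"
    and smult_r_distr:
      "\<lbrakk>a \<in> carrier R; x \<in> carrier M; y \<in> carrier M\<rbrakk> \<Longrightarrow>
       a \<odot>\<^bsub>M\<^esub> (x \<oplus>\<^bsub>M\<^esub> y) = a \<odot>\<^bsub>M\<^esub> x \<oplus>\<^bsub>M\<^esub> a \<odot>\<^bsub>M\<^esub> y"
    and smult_assoc:
      "\<lbrakk>a \<in> carrier R; b \<in> carrier R; x \<in> carrier M\<rbrakk> \<Longrightarrow>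
       (a \<otimes>\<^bsub>R\<^esub> b) \<odot>\<^bsub>M\<^esub> x = b \<odot>\<^bsub>M\<^esub> (a \<odot>\<^bsub>M\<^esub> x)"
    and smult_one:
      "x \<in> carrier M \<Longrightarrow> \<one>\<^bsub>R\<^esub> \<odot>\<^bsub>M\<^esub> x = x"

definition linear_maps ::
  "('r, 'x) ring_scheme \<Rightarrow> ('r, 'a, 'y) module_scheme \<Rightarrow> ('r, 'b, 'z) module_scheme \<Rightarrow> ('a \<Rightarrow> 'b) set"
where
  "linear_maps R A B =
     {f \<in> carrier A \<rightarrow> carrier B.
        (\<forall>x\<in>carrier A. \<forall>y\<in>carrier A. f (x \<oplus>\<^bsub>A\<^esub> y) = f x \<oplus>\<^bsub>B\<^esub> f y) \<and>
        (\<forall>r\<in>carrier R. \<forall>x\<in>carrier A. f (r \<odot>\<^bsub>A\<^esub> x) = r \<odot>\<^bsub>B\<^esub> f x)}"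

text \<open>The tensor product over \<open>R\<close> of a right module \<open>A\<close> and a left module \<open>M\<close>, an abelian group.\<close>

definition tensor_free ::
  "('r, 'a, 'y) module_scheme \<Rightarrow> ('r, 'm, 'z) module_scheme \<Rightarrow> ('a \<times> 'm \<Rightarrow>\<^sub>0 int) monoid"
where
  "tensor_free A M = free_Abelian_group (carrier A \<times> carrier M)"

definition tensor_relators ::
  "('r, 'x) ring_scheme \<Rightarrow> ('r, 'a, 'y) module_scheme \<Rightarrow> ('r, 'm, 'z) module_scheme \<Rightarrow>
   ('a \<times> 'm \<Rightarrow>\<^sub>0 int) set"
where
  "tensor_relators R A M =
     {frag_of (x \<oplus>\<^bsub>A\<^esub> y, m) - frag_of (x, m) - frag_of (y, m) | x y m.
        x \<in> carrier A \<and> y \<in> carrier A \<and> m \<in> carrier M} \<union>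
     {frag_of (x, m \<oplus>\<^bsub>M\<^esub> n) - frag_of (x, m) - frag_of (x, n) | x m n.
        x \<in> carrier A \<and> m \<in> carrier M \<and> n \<in> carrier M} \<union>
     {frag_of (r \<odot>\<^bsub>A\<^esub> x, m) - frag_of (x, r \<odot>\<^bsub>M\<^esub> m) | r x m.
        r \<in> carrier R \<and> x \<in> carrier A \<and> m \<in> carrier M}"

definition tensor_kernel ::
  "('r, 'x) ring_scheme \<Rightarrow> ('r, 'a, 'y) module_scheme \<Rightarrow> ('r, 'm, 'z) module_scheme \<Rightarrow>
   ('a \<times> 'm \<Rightarrow>\<^sub>0 int) set"
where
  "tensor_kernel R A M = generate (tensor_free A M) (tensor_relators R A M)"

definition tensor_product ::
  "('r, 'x) ring_scheme \<Rightarrow> ('r, 'a, 'y) module_scheme \<Rightarrow> ('r, 'm, 'z) module_scheme \<Rightarrow>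
   ('a \<times> 'm \<Rightarrow>\<^sub>0 int) set monoid"
where
  "tensor_product R A M = tensor_free A M Mod tensor_kernel R A M"

text \<open>
  The homomorphism from the tensor product of \<open>A\<close> and \<open>M\<close> to that of \<open>B\<close> and \<open>M\<close> which is
  induced by \<open>f\<close> and the identity of \<open>M\<close>: all representatives \<open>c\<close> of a coset \<open>C\<close> give the
  same coset.
\<close>

definition tensor_map ::
  "('r, 'x) ring_scheme \<Rightarrow> ('r, 'b, 'y) module_scheme \<Rightarrow> ('r, 'm, 'z) module_scheme \<Rightarrow>
   ('a \<Rightarrow> 'b) \<Rightarrow> ('a \<times> 'm \<Rightarrow>\<^sub>0 int) set \<Rightarrow> ('b \<times> 'm \<Rightarrow>\<^sub>0 int) set"
where
  "tensor_map R B M f C =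
     the_elem ((\<lambda>c. r_coset (tensor_free B M) (tensor_kernel R B M)
                       (frag_extend (\<lambda>(x, m). frag_of (f x, m)) c)) ` C)"

text \<open>
  Flatness: tensoring with \<open>M\<close> preserves injectivity of homomorphisms of right modules.
  The modules \<open>A\<close> and \<open>B\<close> range over those whose elements have the type of the elements of
  \<open>R\<close>, since a quantifier cannot range over types.  This is no restriction: the right ideals
  of \<open>R\<close> and \<open>R\<close> itself are among them, and preservation of the injectivity of the inclusions
  of right ideals into \<open>R\<close> implies it for all injective homomorphisms of right modules.
\<close>

locale flat_left_module = left_module R M
  for R :: "('r, 'x) ring_scheme" (structure) and M :: "('r, 'm, 'z) module_scheme" (structure) +
  assumes tensor_map_inj:
    "\<And>(A :: ('r, 'r) module) (B :: ('r, 'r) module) f.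
       \<lbrakk>right_module R A; right_module R B; f \<in> linear_maps R A B; inj_on f (carrier A)\<rbrakk> \<Longrightarrow>
       inj_on (tensor_map R B M f) (carrier (tensor_product R A M))"

text \<open>A ring \<open>S\<close> as a left module along a ring homomorphism \<open>h\<close> into \<open>S\<close>.\<close>

definition module_along :: "('r \<Rightarrow> 's) \<Rightarrow> ('s, 'x) ring_scheme \<Rightarrow> ('r, 's) module" where
  "module_along h S =
     \<lparr>carrier = carrier S, monoid.mult = monoid.mult S, one = one S, ring.zero = ring.zero S, add = add S,
      smult = (\<lambda>r s. h r \<otimes>\<^bsub>S\<^esub> s)\<rparr>"


section \<open>Division closure\<close>

definition division_closed :: "('a, 'x) ring_scheme \<Rightarrow> 'a set \<Rightarrow> bool" where
  "division_closed U D \<longleftrightarrow>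
     (\<forall>x\<in>D. \<forall>y\<in>carrier U. x \<otimes>\<^bsub>U\<^esub> y = \<one>\<^bsub>U\<^esub> \<and> y \<otimes>\<^bsub>U\<^esub> x = \<one>\<^bsub>U\<^esub> \<longrightarrow> y \<in> D)"

definition division_closure :: "('a, 'x) ring_scheme \<Rightarrow> 'a set \<Rightarrow> 'a set" where
  "division_closure U S =
     {x \<in> carrier U. \<forall>D. subring D U \<and> S \<subseteq> D \<and> division_closed U D \<longrightarrow> x \<in> D}"


section \<open>The complex group algebra and the Hilbert space of a group\<close>

text \<open>
  Functions on \<open>G\<close> are represented by functions on the whole type that vanish outside
  \<open>carrier G\<close>.
\<close>

definition convolve ::
  "('g, 'm) monoid_scheme \<Rightarrow> ('g \<Rightarrow> complex) \<Rightarrow> ('g \<Rightarrow> complex) \<Rightarrow> ('g \<Rightarrow> complex)"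
where
  "convolve G a \<xi> =
     (\<lambda>g. if g \<in> carrier G
          then \<Sum>h\<in>{h \<in> carrier G. a h \<noteq> 0}. a h * \<xi> (inv\<^bsub>G\<^esub> h \<otimes>\<^bsub>G\<^esub> g) else 0)"

definition group_algebra :: "('g, 'm) monoid_scheme \<Rightarrow> ('g \<Rightarrow> complex) ring" where
  "group_algebra G =
     \<lparr>carrier = {a. finite {g. a g \<noteq> 0} \<and> (\<forall>g. g \<notin> carrier G \<longrightarrow> a g = 0)},
      monoid.mult = convolve G,
      one = (\<lambda>g. if g = \<one>\<^bsub>G\<^esub> then 1 else 0),
      ring.zero = (\<lambda>g. 0),
      add = (\<lambda>a b g. a g + b g)\<rparr>"

definition ell2 :: "('g, 'm) monoid_scheme \<Rightarrow> ('g \<Rightarrow> complex) set" where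
  "ell2 G = {\<xi>. (\<forall>g. g \<notin> carrier G \<longrightarrow> \<xi> g = 0) \<and> (\<lambda>g. (cmod (\<xi> g))\<^sup>2) summable_on carrier G}"

definition ell2_norm :: "('g, 'm) monoid_scheme \<Rightarrow> ('g \<Rightarrow> complex) \<Rightarrow> real" where
  "ell2_norm G \<xi> = sqrt (\<Sum>\<^sub>\<infinity>g\<in>carrier G. (cmod (\<xi> g))\<^sup>2)"

definition ell2_dist :: "('g, 'm) monoid_scheme \<Rightarrow> ('g \<Rightarrow> complex) \<Rightarrow> ('g \<Rightarrow> complex) \<Rightarrow> real" where
  "ell2_dist G \<xi> \<eta> = ell2_norm G (\<lambda>g. \<xi> g - \<eta> g)"


section \<open>Operators\<close>

text \<open>
  A possibly unbounded operator is represented by its graph; its domain is then the relational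
  \<open>Domain\<close>, and the composition \<open>S\<close> after \<open>T\<close>, with its natural domain, is the relational
  product \<open>T O S\<close>.
\<close>

type_synonym 'g operator = "(('g \<Rightarrow> complex) \<times> ('g \<Rightarrow> complex)) set"

definition linear_operator :: "('g, 'm) monoid_scheme \<Rightarrow> 'g operator \<Rightarrow> bool" where
  "linear_operator G T \<longleftrightarrow>
     T \<subseteq> ell2 G \<times> ell2 G \<and> single_valued T \<and> (\<lambda>_. 0, \<lambda>_. 0) \<in> T \<and>
     (\<forall>(\<xi>, \<eta>)\<in>T. \<forall>(\<xi>', \<eta>')\<in>T. (\<lambda>g. \<xi> g + \<xi>' g, \<lambda>g. \<eta> g + \<eta>' g) \<in> T) \<and>
     (\<forall>c. \<forall>(\<xi>, \<eta>)\<in>T. (\<lambda>g. c * \<xi> g, \<lambda>g. c * \<eta> g) \<in> T)"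

definition bounded_operator :: "('g, 'm) monoid_scheme \<Rightarrow> 'g operator \<Rightarrow> bool" where
  "bounded_operator G T \<longleftrightarrow>
     linear_operator G T \<and> Domain T = ell2 G \<and>
     (\<exists>C. \<forall>(\<xi>, \<eta>)\<in>T. ell2_norm G \<eta> \<le> C * ell2_norm G \<xi>)"

definition unitary_operator :: "('g, 'm) monoid_scheme \<Rightarrow> 'g operator \<Rightarrow> bool" where
  "unitary_operator G T \<longleftrightarrow>
     bounded_operator G T \<and> Range T = ell2 G \<and> (\<forall>(\<xi>, \<eta>)\<in>T. ell2_norm G \<eta> = ell2_norm G \<xi>)"

definition operator_closure :: "('g, 'm) monoid_scheme \<Rightarrow> 'g operator \<Rightarrow> 'g operator" where
  "operator_closure G T =
     {(\<xi>, \<eta>) \<in> ell2 G \<times> ell2 G.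
        \<forall>\<epsilon>>0. \<exists>(\<xi>', \<eta>')\<in>T. ell2_dist G \<xi> \<xi>' < \<epsilon> \<and> ell2_dist G \<eta> \<eta>' < \<epsilon>}"

definition closed_operator :: "('g, 'm) monoid_scheme \<Rightarrow> 'g operator \<Rightarrow> bool" where
  "closed_operator G T \<longleftrightarrow> linear_operator G T \<and> operator_closure G T = T"

definition densely_defined :: "('g, 'm) monoid_scheme \<Rightarrow> 'g operator \<Rightarrow> bool" where
  "densely_defined G T \<longleftrightarrow> (\<forall>\<xi>\<in>ell2 G. \<forall>\<epsilon>>0. \<exists>\<xi>'\<in>Domain T. ell2_dist G \<xi> \<xi>' < \<epsilon>)"

definition operator_sum :: "'g operator \<Rightarrow> 'g operator \<Rightarrow> 'g operator" where
  "operator_sum S T = {(\<xi>, \<lambda>g. \<eta> g + \<zeta> g) | \<xi> \<eta> \<zeta>. (\<xi>, \<eta>) \<in> S \<and> (\<xi>, \<zeta>) \<in> T}"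

definition left_multiplication ::
  "('g, 'm) monoid_scheme \<Rightarrow> ('g \<Rightarrow> complex) \<Rightarrow> 'g operator"
where
  "left_multiplication G a = {(\<xi>, convolve G a \<xi>) | \<xi>. \<xi> \<in> ell2 G}"

definition right_translation :: "('g, 'm) monoid_scheme \<Rightarrow> 'g \<Rightarrow> 'g operator" where
  "right_translation G g =
     {(\<xi>, \<lambda>h. if h \<in> carrier G then \<xi> (h \<otimes>\<^bsub>G\<^esub> g) else 0) | \<xi>. \<xi> \<in> ell2 G}"


section \<open>The group von Neumann algebra and its affiliated operators\<close>

definition group_von_Neumann :: "('g, 'm) monoid_scheme \<Rightarrow> 'g operator set" where
  "group_von_Neumann G =
     {T. bounded_operator G T \<and>
         (\<forall>g\<in>carrier G. T O right_translation G g = right_translation G g O T)}"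

definition commutant :: "('g, 'm) monoid_scheme \<Rightarrow> 'g operator set \<Rightarrow> 'g operator set" where
  "commutant G N = {S. bounded_operator G S \<and> (\<forall>T\<in>N. T O S = S O T)}"

definition affiliated :: "('g, 'm) monoid_scheme \<Rightarrow> 'g operator set \<Rightarrow> 'g operator \<Rightarrow> bool" where
  "affiliated G N T \<longleftrightarrow>
     closed_operator G T \<and> densely_defined G T \<and>
     (\<forall>W\<in>commutant G N. unitary_operator G W \<longrightarrow> T O W = W O T)"

definition affiliated_ring :: "('g, 'm) monoid_scheme \<Rightarrow> 'g operator ring" where
  "affiliated_ring G =
     \<lparr>carrier = {T. affiliated G (group_von_Neumann G) T},
      monoid.mult = (\<lambda>S T. operator_closure G (T O S)),
      one = Id_on (ell2 G),
      ring.zero = ell2 G \<times> {\<lambda>_. 0},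
      add = (\<lambda>S T. operator_closure G (operator_sum S T))\<rparr>"

definition division_closure_ring :: "('g, 'm) monoid_scheme \<Rightarrow> 'g operator ring" where
  "division_closure_ring G =
     (affiliated_ring G)\<lparr>carrier :=
        division_closure (affiliated_ring G)
          (left_multiplication G ` carrier (group_algebra G))\<rparr>"

text \<open>Both rings as left modules over the group algebra, which acts by left multiplication.\<close>

definition affiliated_module :: "('g, 'm) monoid_scheme \<Rightarrow> ('g \<Rightarrow> complex, 'g operator) module" where
  "affiliated_module G = module_along (left_multiplication G) (affiliated_ring G)"

definition division_closure_module ::
  "('g, 'm) monoid_scheme \<Rightarrow> ('g \<Rightarrow> complex, 'g operator) module"
where
  "division_closure_module G = module_along (left_multiplication G) (division_closure_ring G)"

end

theory Submission
  imports Defs "HOL-Analysis.L2_Norm"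
begin

text \<open>
  Write \<open>p = x - 1\<close> and \<open>q = a - 1\<close>, where \<open>x\<close> is the generator of the integers and \<open>a \<noteq> 1\<close> lies in the
  copy of \<open>H\<close> at index \<open>0\<close>; let \<open>a\<^sub>i = x\<^sup>i a x\<^sup>-\<^sup>i\<close>.  Since \<open>x\<close> has infinite order, \<open>p\<close> is injective with
  dense range on the Hilbert space, so it is invertible among the affiliated operators, and
  \<open>u = p\<^sup>-\<^sup>1 q\<close> belongs to the division closure.  It satisfies the relation \<open>p u = q 1\<close>.

  Over a flat module such a relation follows from relations in the group algebra:
  \<open>u\<close> is a sum of terms \<open>\<alpha> m\<close> in which \<open>p \<alpha> = q \<beta>\<close> for some \<open>\<alpha>\<close>, \<open>\<beta>\<close> in the group algebra.  The form of
  this criterion used here is \<open>relation_coordinate_absorbed\<close>.  For every such \<open>\<alpha>\<close> the sums over the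
  cosets \<open>B g\<close> of the base group are unchanged under translation by \<open>x\<close>, because \<open>q \<beta>\<close> has vanishing
  sums over these cosets; as the translates are different cosets and \<open>\<alpha>\<close> has finite support, they are
  all zero.  Now \<open>H\<close> is finite, so \<open>B\<close> is the increasing union of the finite groups \<open>B\<^sub>n\<close> of
  configurations supported in \<open>[-n, n]\<close>, and therefore \<open>\<alpha>\<close> is annihilated by the sum \<open>N\<^sub>n\<close> of the
  elements of \<open>B\<^sub>n\<close> for all large \<open>n\<close> (\<open>window_sum_annihilates\<close>).  Flatness thus forces \<open>N\<^sub>n u = 0\<close> for
  some \<open>n\<close>.

  This fails because the elements \<open>a\<^sub>i\<close> commute.  For every \<open>k\<close>,
  \<open>(x\<^sup>k - 1) (a\<^sub>0 - 1) (a\<^sub>-\<^sub>k - 1) = (a\<^sub>0 - 1) ((a\<^sub>k - 1) x\<^sup>k - (a\<^sub>-\<^sub>k - 1))\<close>.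
  Dividing by \<open>p\<close> on the left, one sees that \<open>u\<close> maps the vector \<open>(a\<^sub>k - 1) x\<^sup>k - (a\<^sub>-\<^sub>k - 1)\<close> to
  \<open>\<eta> = (1 + x + \<dots> + x\<^sup>k\<^sup>-\<^sup>1) (a\<^sub>0 - 1) (a\<^sub>-\<^sub>k - 1)\<close>.  For \<open>k = 2 (n + 1)\<close> the coefficient of \<open>N\<^sub>n \<eta>\<close> at \<open>x\<^sup>n\<^sup>+\<^sup>1\<close> is
  \<open>1\<close>: in the middle of the sum, conjugation by \<open>x\<^sup>n\<^sup>+\<^sup>1\<close> moves the two indices just outside the window
  \<open>[-n, n]\<close> (\<open>window_sum_swap_quotient\<close>).

  The general theory of affiliated operators can be bypassed, since \<open>u\<close> is the explicit operator
  with graph \<open>p \<eta> = q \<xi>\<close>.  Its graph is closed and commutes with the commutant because left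
  multiplications do; the only point of substance is that its domain is dense.  By the identity
  above, the domain contains \<open>1 - a\<^sub>-\<^sub>k - x\<^sup>k + a\<^sub>k x\<^sup>k\<close> for every \<open>k\<close>, and the averages of these
  elements over \<open>k = 1, \<dots>, N\<close> converge to \<open>1\<close> in square mean.
\<close>

section \<open>Relations over flat modules\<close>

definition right_ideal_module :: "('r, 'x) ring_scheme \<Rightarrow> 'r set \<Rightarrow> ('r, 'r) module" where
  "right_ideal_module R I =
     \<lparr>carrier = I, monoid.mult = monoid.mult R, one = one R, ring.zero = ring.zero R, add = add R,
      smult = (\<lambda>r s. s \<otimes>\<^bsub>R\<^esub> r)\<rparr>"

lemma right_ideal_module_simps [simp]:
  "carrier (right_ideal_module R I) = I"
  "\<zero>\<^bsub>right_ideal_module R I\<^esub> = \<zero>\<^bsub>R\<^esub>"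
  "x \<oplus>\<^bsub>right_ideal_module R I\<^esub> y = x \<oplus>\<^bsub>R\<^esub> y"
  "r \<odot>\<^bsub>right_ideal_module R I\<^esub> x = x \<otimes>\<^bsub>R\<^esub> r"
  by (simp_all add: right_ideal_module_def)

lemma (in ring) right_module_right_ideal:
  assumes sub: "I \<subseteq> carrier R" and zero: "\<zero> \<in> I"
    and add: "\<And>x y. x \<in> I \<Longrightarrow> y \<in> I \<Longrightarrow> x \<oplus> y \<in> I"
    and mult: "\<And>x r. x \<in> I \<Longrightarrow> r \<in> carrier R \<Longrightarrow> x \<otimes> r \<in> I"
  shows "right_module R (right_ideal_module R I)"
proof -
  have c: "x \<in> carrier R" if "x \<in> I" for x
    using that sub by blast
  have neg: "\<exists>y\<in>I. y \<oplus> x = \<zero>" if "x \<in> I" for x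
  proof
    show "x \<otimes> (\<ominus> \<one>) \<in> I"
      using that by (intro mult) auto
    show "x \<otimes> (\<ominus> \<one>) \<oplus> x = \<zero>"
      using c[OF that] by (simp add: r_minus l_neg)
  qed
  have grp: "abelian_group (right_ideal_module R I)"
    by (rule abelian_groupI) (use zero add neg c in \<open>auto simp: a_ac\<close>)
  show ?thesis
    unfolding right_module_def right_module_axioms_def
    using ring_axioms grp mult c by (auto simp: l_distr r_distr m_assoc)
qed

lemma (in left_module) smult_l_null: "x \<in> carrier M \<Longrightarrow> \<zero> \<odot>\<^bsub>M\<^esub> x = \<zero>\<^bsub>M\<^esub>"
  using smult_l_distr[of \<zero> \<zero> x] smult_closed[of \<zero> x] by (simp add: M.add.l_cancel_one)

lemma (in left_module) smult_r_null: "a \<in> carrier R \<Longrightarrow> a \<odot>\<^bsub>M\<^esub> \<zero>\<^bsub>M\<^esub> = \<zero>\<^bsub>M\<^esub>"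
  using smult_r_distr[of a "\<zero>\<^bsub>M\<^esub>" "\<zero>\<^bsub>M\<^esub>"] smult_closed[of a "\<zero>\<^bsub>M\<^esub>"]
  by (simp add: M.add.l_cancel_one)

lemma (in left_module) smult_l_minus:
  assumes "a \<in> carrier R" "x \<in> carrier M"
  shows "(\<ominus> a) \<odot>\<^bsub>M\<^esub> x = \<ominus>\<^bsub>M\<^esub> (a \<odot>\<^bsub>M\<^esub> x)"
proof -
  have "(\<ominus> a) \<odot>\<^bsub>M\<^esub> x \<oplus>\<^bsub>M\<^esub> a \<odot>\<^bsub>M\<^esub> x = \<zero>\<^bsub>M\<^esub>"
    using smult_l_distr[of "\<ominus> a" a x] assms smult_l_null by (simp add: R.l_neg)
  then show ?thesis
    using assms smult_closed by (simp add: M.minus_equality)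
qed

lemma (in left_module) smult_r_minus:
  assumes "a \<in> carrier R" "x \<in> carrier M"
  shows "a \<odot>\<^bsub>M\<^esub> (\<ominus>\<^bsub>M\<^esub> x) = \<ominus>\<^bsub>M\<^esub> (a \<odot>\<^bsub>M\<^esub> x)"
proof -
  have "a \<odot>\<^bsub>M\<^esub> (\<ominus>\<^bsub>M\<^esub> x) \<oplus>\<^bsub>M\<^esub> a \<odot>\<^bsub>M\<^esub> x = \<zero>\<^bsub>M\<^esub>"
    using smult_r_distr[of a "\<ominus>\<^bsub>M\<^esub> x" x] assms smult_r_null by (simp add: M.l_neg)
  then show ?thesis
    using assms smult_closed by (simp add: M.minus_equality)
qed

text \<open>
  Tensor the inclusion of the right ideal \<open>I = p R + q R\<close> into \<open>R\<close> with the module.  The relation says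
  that \<open>p\<close> tensor \<open>u\<close> minus \<open>q\<close> tensor \<open>v\<close> vanishes over \<open>R\<close>, hence by flatness over \<open>I\<close>.  Sending
  \<open>p \<alpha> + q \<beta>\<close> tensor \<open>m\<close> to \<open>\<alpha> m\<close> is well defined and balanced modulo \<open>Z\<close>, because \<open>\<alpha>\<close> is unique up to
  the first coordinates of solutions of \<open>p \<alpha> = q \<beta>\<close>; the vanishing tensor goes to the class of \<open>u\<close>.
\<close>

lemma (in flat_left_module) relation_coordinate_absorbed:
  assumes p: "p \<in> carrier R" and q: "q \<in> carrier R"
    and u: "u \<in> carrier M" and v: "v \<in> carrier M"
    and rel: "p \<odot>\<^bsub>M\<^esub> u = q \<odot>\<^bsub>M\<^esub> v"
    and Z: "subgroup Z (add_monoid M)"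
    and absorb: "\<And>\<alpha> \<beta> m. \<lbrakk>\<alpha> \<in> carrier R; \<beta> \<in> carrier R; p \<otimes> \<alpha> = q \<otimes> \<beta>; m \<in> carrier M\<rbrakk>
                  \<Longrightarrow> \<alpha> \<odot>\<^bsub>M\<^esub> m \<in> Z"
  shows "u \<in> Z"
proof -
  (* A sum instead of a difference keeps the ideal and its elements free of signs. *)
  define w where "w = \<ominus>\<^bsub>M\<^esub> v"
  have w: "w \<in> carrier M"
    using v by (simp add: w_def)
  have rel0: "p \<odot>\<^bsub>M\<^esub> u \<oplus>\<^bsub>M\<^esub> q \<odot>\<^bsub>M\<^esub> w = \<zero>\<^bsub>M\<^esub>"
    using q v smult_closed by (simp add: w_def rel smult_r_minus M.r_neg)
  have absorb0: "\<alpha> \<odot>\<^bsub>M\<^esub> m \<in> Z"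
    if "\<alpha> \<in> carrier R" "\<beta> \<in> carrier R" "p \<otimes> \<alpha> \<oplus> q \<otimes> \<beta> = \<zero>" "m \<in> carrier M" for \<alpha> \<beta> m
  proof (rule absorb)
    show "p \<otimes> \<alpha> = q \<otimes> (\<ominus> \<beta>)"
      using that p q by (simp add: R.r_minus R.minus_equality)
  qed (use that in auto)
  define I where "I = {p \<otimes> \<alpha> \<oplus> q \<otimes> \<beta> | \<alpha> \<beta>. \<alpha> \<in> carrier R \<and> \<beta> \<in> carrier R}"
  define A where "A = right_ideal_module R I"
  define B where "B = right_ideal_module R (carrier R)"
  have II: "p \<otimes> \<alpha> \<oplus> q \<otimes> \<beta> \<in> I" if "\<alpha> \<in> carrier R" "\<beta> \<in> carrier R" for \<alpha> \<beta>
    using that by (auto simp: I_def)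
  have I_sub: "I \<subseteq> carrier R"
    using p q by (auto simp: I_def)
  have I_zero: "\<zero> \<in> I"
    using II[of \<zero> \<zero>] p q by simp
  have pI: "p \<in> I"
    using II[of \<one> \<zero>] p q by simp
  have qI: "q \<in> I"
    using II[of \<zero> \<one>] p q by simp
  have sum_eq: "(p \<otimes> \<alpha> \<oplus> q \<otimes> \<beta>) \<oplus> (p \<otimes> \<alpha>' \<oplus> q \<otimes> \<beta>') = p \<otimes> (\<alpha> \<oplus> \<alpha>') \<oplus> q \<otimes> (\<beta> \<oplus> \<beta>')"
    if "\<alpha> \<in> carrier R" "\<beta> \<in> carrier R" "\<alpha>' \<in> carrier R" "\<beta>' \<in> carrier R" for \<alpha> \<beta> \<alpha>' \<beta>'
    using that p q by (simp add: r_distr R.a_ac)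
  have mult_eq: "(p \<otimes> \<alpha> \<oplus> q \<otimes> \<beta>) \<otimes> r = p \<otimes> (\<alpha> \<otimes> r) \<oplus> q \<otimes> (\<beta> \<otimes> r)"
    if "\<alpha> \<in> carrier R" "\<beta> \<in> carrier R" "r \<in> carrier R" for \<alpha> \<beta> r
    using that p q by (simp add: l_distr R.m_assoc)
  have I_add: "x \<oplus> y \<in> I" if "x \<in> I" "y \<in> I" for x y
    using that sum_eq unfolding I_def mem_Collect_eq by (metis R.add.m_closed)
  have I_mult: "x \<otimes> r \<in> I" if "x \<in> I" "r \<in> carrier R" for x r
    using that mult_eq unfolding I_def mem_Collect_eq by (metis R.m_closed)
  have rA: "right_module R A"
    unfolding A_def by (rule right_module_right_ideal) (use I_sub I_zero I_add I_mult in auto)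
  have rB: "right_module R B"
    unfolding B_def by (rule right_module_right_ideal) auto
  have carA: "carrier A = I" and carB: "carrier B = carrier R"
    by (simp_all add: A_def B_def)
  have lin: "(\<lambda>x. x) \<in> linear_maps R A B"
    using I_sub by (auto simp: linear_maps_def A_def B_def)
  have inj: "inj_on (tensor_map R B M (\<lambda>x. x)) (carrier (tensor_product R A M))"
    by (rule tensor_map_inj[OF rA rB lin]) simp
  define FA where "FA = tensor_free A M"
  define FB where "FB = tensor_free B M"
  define KA where "KA = tensor_kernel R A M"
  define KB where "KB = tensor_kernel R B M"
  have FA: "FA = free_Abelian_group (I \<times> carrier M)"
    and FB: "FB = free_Abelian_group (carrier R \<times> carrier M)"
    by (simp_all add: FA_def FB_def tensor_free_def carA carB)
  interpret FA: group FA by (simp add: FA)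
  interpret FB: group FB by (simp add: FB)
  have car_diff: "a - b \<in> carrier (free_Abelian_group S)"
    if "a \<in> carrier (free_Abelian_group S)" "b \<in> carrier (free_Abelian_group S)"
    for a b :: "'r \<times> 'm \<Rightarrow>\<^sub>0 int" and S
    using that keys_diff[of a b] by auto
  have relA: "tensor_relators R A M \<subseteq> carrier FA"
    using I_add I_mult smult_closed unfolding tensor_relators_def FA carA
    by (intro Un_least) (auto intro!: car_diff simp: A_def simp del: carrier_free_Abelian_group_iff)
  have relB: "tensor_relators R B M \<subseteq> carrier FB"
    using smult_closed unfolding tensor_relators_def FB carB
    by (intro Un_least) (auto intro!: car_diff simp: B_def simp del: carrier_free_Abelian_group_iff)
  have KA_sub: "subgroup KA FA"
    unfolding KA_def tensor_kernel_def FA_def[symmetric] by (rule FA.generate_is_subgroup[OF relA])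
  have KB_sub: "subgroup KB FB"
    unfolding KB_def tensor_kernel_def FB_def[symmetric] by (rule FB.generate_is_subgroup[OF relB])
  have KB_rel: "c \<in> KB" if "c \<in> tensor_relators R B M" for c
    unfolding KB_def tensor_kernel_def using that by (rule generate.incl)
  have KB_add: "c + d \<in> KB" if "c \<in> KB" "d \<in> KB" for c d
    using subgroup.m_closed[OF KB_sub that] by (simp add: FB)
  have KB_neg: "- c \<in> KB" if "c \<in> KB" for c
    using subgroup.m_inv_closed[OF KB_sub that] subgroup.mem_carrier[OF KB_sub that]
    by (simp add: FB)
  have KB_diff: "c - d \<in> KB" if "c \<in> KB" "d \<in> KB" for c d
    using KB_add[OF that(1) KB_neg[OF that(2)]] by simp
  have rel_AB: "tensor_relators R A M \<subseteq> tensor_relators R B M"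
    using I_sub unfolding tensor_relators_def carA carB A_def B_def right_ideal_module_simps by blast
  have KA_KB: "KA \<subseteq> KB"
  proof
    fix c assume "c \<in> KA"
    then have "c \<in> generate FA (tensor_relators R A M)"
      by (simp add: KA_def tensor_kernel_def FA_def)
    then show "c \<in> KB"
    proof induction
      case one
      show ?case using subgroup.one_closed[OF KB_sub] by (simp add: FA FB)
    next
      case (incl h)
      then show ?case using rel_AB KB_rel by blast
    next
      case (inv h)
      then have "Poly_Mapping.keys h \<subseteq> I \<times> carrier M"
        using relA unfolding FA by (metis carrier_free_Abelian_group_iff subsetD)
      moreover have "h \<in> KB"
        using inv rel_AB KB_rel by blast
      ultimately show ?case using KB_neg[of h] by (simp add: FA)
    next
      case (eng h1 h2)
      then show ?case using KB_add by (simp add: FA)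
    qed
  qed

  (* The tensor \<open>t\<close> vanishes over \<open>R\<close>: move \<open>p\<close> and \<open>q\<close> from the elements \<open>p 1\<close> and \<open>q 1\<close> of the left
     factor to the right factor and use the relation. *)
  define t where "t = frag_of (p, u) + frag_of (q, w)"
  have tA: "t \<in> carrier FA"
    using FA.m_closed[of "frag_of (p, u)" "frag_of (q, w)"] pI qI u w by (simp add: FA t_def)
  have tB: "t \<in> KB"
  proof -
    let ?f = "\<lambda>x m. frag_of (x, m) :: 'r \<times> 'm \<Rightarrow>\<^sub>0 int"
    have pu: "p \<odot>\<^bsub>M\<^esub> u \<in> carrier M" and qv: "q \<odot>\<^bsub>M\<^esub> w \<in> carrier M"
      using p q u w smult_closed by auto
    have move: "?f r m - ?f \<one> (r \<odot>\<^bsub>M\<^esub> m) \<in> KB" if "r \<in> carrier R" "m \<in> carrier M" for r m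
    proof -
      have "?f (r \<odot>\<^bsub>B\<^esub> \<one>) m - ?f \<one> (r \<odot>\<^bsub>M\<^esub> m) \<in> tensor_relators R B M"
        unfolding tensor_relators_def carB using that R.one_closed by blast
      from KB_rel[OF this] show ?thesis using that by (simp add: B_def)
    qed
    have split: "?f \<one> (m \<oplus>\<^bsub>M\<^esub> n) - ?f \<one> m - ?f \<one> n \<in> KB"
      if "m \<in> carrier M" "n \<in> carrier M" for m n
      by (rule KB_rel) (unfold tensor_relators_def carB, use that R.one_closed in \<open>blast\<close>)
    have "- (?f \<one> (\<zero>\<^bsub>M\<^esub> \<oplus>\<^bsub>M\<^esub> \<zero>\<^bsub>M\<^esub>) - ?f \<one> \<zero>\<^bsub>M\<^esub> - ?f \<one> \<zero>\<^bsub>M\<^esub>) \<in> KB"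
      by (rule KB_neg[OF split]) auto
    then have z: "?f \<one> \<zero>\<^bsub>M\<^esub> \<in> KB"
      by simp
    have s: "?f \<one> \<zero>\<^bsub>M\<^esub> - ?f \<one> (p \<odot>\<^bsub>M\<^esub> u) - ?f \<one> (q \<odot>\<^bsub>M\<^esub> w) \<in> KB"
      using split[OF pu qv] by (simp add: rel0)
    have "t = (?f p u - ?f \<one> (p \<odot>\<^bsub>M\<^esub> u)) + (?f q w - ?f \<one> (q \<odot>\<^bsub>M\<^esub> w))
               - (?f \<one> \<zero>\<^bsub>M\<^esub> - ?f \<one> (p \<odot>\<^bsub>M\<^esub> u) - ?f \<one> (q \<odot>\<^bsub>M\<^esub> w)) + ?f \<one> \<zero>\<^bsub>M\<^esub>"
      by (simp add: t_def)
    then show ?thesis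
      using KB_add[OF KB_diff[OF KB_add[OF move[OF p u] move[OF q w]] s] z] by simp
  qed

  have ext_id: "frag_extend (\<lambda>(x, m). frag_of (x, m)) c = c" for c :: "'r \<times> 'm \<Rightarrow>\<^sub>0 int"
    using frag_expansion[of c] by (simp add: case_prod_beta')
  have map_zero: "tensor_map R B M (\<lambda>x. x) (KA #>\<^bsub>FA\<^esub> c) = KB" if c: "c \<in> KB" for c
  proof -
    have "KB #>\<^bsub>FB\<^esub> d = KB" if d: "d \<in> KA #>\<^bsub>FA\<^esub> c" for d
    proof -
      obtain k where k: "k \<in> KA" "d = k + c"
        using d by (auto simp: r_coset_def FA)
      then have "d \<in> KB"
        using KA_KB KB_add c by blast
      then show ?thesis
        using FB.coset_join2[OF _ KB_sub] subgroup.mem_carrier[OF KB_sub] by blast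
    qed
    moreover have "KA #>\<^bsub>FA\<^esub> c \<noteq> {}"
      using subgroup.one_closed[OF KA_sub] by (auto simp: r_coset_def)
    ultimately have "(\<lambda>d. KB #>\<^bsub>FB\<^esub> d) ` (KA #>\<^bsub>FA\<^esub> c) = {KB}"
      by auto
    then show ?thesis
      by (simp add: tensor_map_def ext_id FB_def KB_def)
  qed
  have coset: "KA #>\<^bsub>FA\<^esub> c \<in> carrier (tensor_product R A M)" if "c \<in> carrier FA" for c
    using that by (auto simp: tensor_product_def FactGroup_def RCOSETS_def FA_def KA_def)
  have zeroKB: "0 \<in> KB"
    using subgroup.one_closed[OF KB_sub] by (simp add: FB)
  have "KA #>\<^bsub>FA\<^esub> t = KA #>\<^bsub>FA\<^esub> 0"
  proof (rule inj_onD[OF inj])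
    show "tensor_map R B M (\<lambda>x. x) (KA #>\<^bsub>FA\<^esub> t) = tensor_map R B M (\<lambda>x. x) (KA #>\<^bsub>FA\<^esub> 0)"
      by (simp only: map_zero tB zeroKB)
  qed (use tA coset[of 0] coset[of t] in \<open>simp_all add: FA\<close>)
  then have tKA: "t \<in> KA"
    using FA.rcos_self[OF tA KA_sub] FA.coset_mult_one[OF subgroup.subset[OF KA_sub]]
    by (simp add: FA)

  interpret Z: subgroup Z "add_monoid M" by (rule Z)
  define \<alpha> where "\<alpha> x = (SOME \<alpha>. \<alpha> \<in> carrier R \<and> (\<exists>\<beta>\<in>carrier R. x = p \<otimes> \<alpha> \<oplus> q \<otimes> \<beta>))" for x
  have \<alpha>: "\<alpha> x \<in> carrier R \<and> (\<exists>\<beta>\<in>carrier R. x = p \<otimes> \<alpha> x \<oplus> q \<otimes> \<beta>)" if "x \<in> I" for x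
    unfolding \<alpha>_def by (rule someI_ex) (use that in \<open>auto simp: I_def\<close>)
  (* The first coordinate is a choice, so the map is additive and balanced only modulo \<open>Z\<close>: any
     other coordinate \<open>\<gamma>\<close> of the same element acts in the same way up to \<open>Z\<close>. *)
  have \<alpha>_cong: "\<gamma> \<odot>\<^bsub>M\<^esub> m \<ominus>\<^bsub>M\<^esub> \<alpha> x \<odot>\<^bsub>M\<^esub> m \<in> Z"
    if "x = p \<otimes> \<gamma> \<oplus> q \<otimes> \<beta>" "\<gamma> \<in> carrier R" "\<beta> \<in> carrier R" "m \<in> carrier M" for x \<gamma> \<beta> m
  proof -
    have "x \<in> I"
      using that II by simp
    then obtain \<beta>' where a: "\<alpha> x \<in> carrier R" "\<beta>' \<in> carrier R" "x = p \<otimes> \<alpha> x \<oplus> q \<otimes> \<beta>'"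
      using \<alpha> by blast
    have "p \<otimes> (\<gamma> \<oplus> \<ominus> \<alpha> x) \<oplus> q \<otimes> (\<beta> \<oplus> \<ominus> \<beta>') = (p \<otimes> \<gamma> \<oplus> q \<otimes> \<beta>) \<oplus> \<ominus> (p \<otimes> \<alpha> x \<oplus> q \<otimes> \<beta>')"
      using that a(1,2) p q by (simp add: r_distr R.r_minus R.minus_add R.a_ac)
    also have "\<dots> = \<zero>"
      using a I_sub \<open>x \<in> I\<close> that by (metis R.r_neg subsetD)
    finally have "(\<gamma> \<oplus> \<ominus> \<alpha> x) \<odot>\<^bsub>M\<^esub> m \<in> Z"
      using absorb0[of "\<gamma> \<oplus> \<ominus> \<alpha> x" "\<beta> \<oplus> \<ominus> \<beta>'" m] that a by simp
    then show ?thesis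
      using that a by (simp add: smult_l_distr smult_l_minus a_minus_def)
  qed
  have comm: "comm_group (add_monoid M)"
    by (rule M.a_comm_group)
  obtain h where h_hom: "h \<in> hom FA (add_monoid M)"
    and h: "\<And>y. y \<in> I \<times> carrier M \<Longrightarrow> h (frag_of y) = (case y of (x, m) \<Rightarrow> \<alpha> x \<odot>\<^bsub>M\<^esub> m)"
    unfolding FA
    by (rule comm_group.free_Abelian_group_universal[OF comm,
          of "\<lambda>(x, m). \<alpha> x \<odot>\<^bsub>M\<^esub> m" "I \<times> carrier M"]) (use \<alpha> smult_closed in auto)
  interpret h: group_hom FA "add_monoid M" h
    unfolding group_hom_def group_hom_axioms_def using h_hom comm FA.is_group
    by (simp add: comm_group_def)
  have h_diff: "h (c - d) = h c \<ominus>\<^bsub>M\<^esub> h d" if "c \<in> carrier FA" "d \<in> carrier FA" for c d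
  proof -
    have "c - d = c \<otimes>\<^bsub>FA\<^esub> inv\<^bsub>FA\<^esub> d"
      using that by (simp add: FA)
    then show ?thesis
      using that h.hom_mult[of c "inv\<^bsub>FA\<^esub> d"] h.hom_inv[of d]
      by (simp add: a_minus_def a_inv_def)
  qed
  have Zneg: "\<ominus>\<^bsub>M\<^esub> z \<in> Z" if "z \<in> Z" for z
    using Z.m_inv_closed[OF that] by (simp add: a_inv_def)
  have Zadd: "y \<oplus>\<^bsub>M\<^esub> z \<in> Z" if "y \<in> Z" "z \<in> Z" for y z
    using Z.m_closed[OF that] by simp
  have Zcar: "z \<in> carrier M" if "z \<in> Z" for z
    using Z.subset that by auto
  have hf: "h (frag_of (x, m)) = \<alpha> x \<odot>\<^bsub>M\<^esub> m" if "x \<in> I" "m \<in> carrier M" for x m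
    using h that by simp
  have fc: "frag_of (x, m) \<in> carrier FA" if "x \<in> I" "m \<in> carrier M" for x m
    using that by (simp add: FA)
  have dc: "c - d \<in> carrier FA" if "c \<in> carrier FA" "d \<in> carrier FA" for c d
    using that car_diff unfolding FA by blast
  (* On each of the three kinds of relators, compare the chosen coordinate of the combined element
     with the combination of the chosen coordinates. *)
  have h_rel: "h c \<in> Z" if "c \<in> tensor_relators R A M" for c
  proof -
    consider (l) x y m where "x \<in> I" "y \<in> I" "m \<in> carrier M"
        "c = frag_of (x \<oplus> y, m) - frag_of (x, m) - frag_of (y, m)"
      | (r) x m n where "x \<in> I" "m \<in> carrier M" "n \<in> carrier M"
        "c = frag_of (x, m \<oplus>\<^bsub>M\<^esub> n) - frag_of (x, m) - frag_of (x, n)"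
      | (b) r x m where "r \<in> carrier R" "x \<in> I" "m \<in> carrier M"
        "c = frag_of (x \<otimes> r, m) - frag_of (x, r \<odot>\<^bsub>M\<^esub> m)"
      using \<open>c \<in> tensor_relators R A M\<close> unfolding tensor_relators_def A_def right_ideal_module_simps
      by blast
    then show ?thesis
    proof cases
      case l
      obtain \<beta> \<beta>' where b: "\<beta> \<in> carrier R" "x = p \<otimes> \<alpha> x \<oplus> q \<otimes> \<beta>"
        "\<beta>' \<in> carrier R" "y = p \<otimes> \<alpha> y \<oplus> q \<otimes> \<beta>'"
        using \<alpha>[OF l(1)] \<alpha>[OF l(2)] by blast
      have ac: "\<alpha> x \<in> carrier R" "\<alpha> y \<in> carrier R" "\<alpha> (x \<oplus> y) \<in> carrier R"
        using \<alpha> l I_add by blast+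
      have "x \<oplus> y = p \<otimes> (\<alpha> x \<oplus> \<alpha> y) \<oplus> q \<otimes> (\<beta> \<oplus> \<beta>')"
        using sum_eq[of "\<alpha> x" \<beta> "\<alpha> y" \<beta>'] b ac by simp
      then have "(\<alpha> x \<oplus> \<alpha> y) \<odot>\<^bsub>M\<^esub> m \<ominus>\<^bsub>M\<^esub> \<alpha> (x \<oplus> y) \<odot>\<^bsub>M\<^esub> m \<in> Z"
        by (rule \<alpha>_cong) (use l ac b in auto)
      then have "\<ominus>\<^bsub>M\<^esub> ((\<alpha> x \<oplus> \<alpha> y) \<odot>\<^bsub>M\<^esub> m \<ominus>\<^bsub>M\<^esub> \<alpha> (x \<oplus> y) \<odot>\<^bsub>M\<^esub> m) \<in> Z"
        by (rule Zneg)
      also have "\<ominus>\<^bsub>M\<^esub> ((\<alpha> x \<oplus> \<alpha> y) \<odot>\<^bsub>M\<^esub> m \<ominus>\<^bsub>M\<^esub> \<alpha> (x \<oplus> y) \<odot>\<^bsub>M\<^esub> m)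
        = \<alpha> (x \<oplus> y) \<odot>\<^bsub>M\<^esub> m \<ominus>\<^bsub>M\<^esub> \<alpha> x \<odot>\<^bsub>M\<^esub> m \<ominus>\<^bsub>M\<^esub> \<alpha> y \<odot>\<^bsub>M\<^esub> m"
        using ac l smult_closed
        by (simp add: smult_l_distr a_minus_def M.minus_add M.a_ac)
      also have "\<dots> = h c"
        using l by (simp add: h_diff hf fc dc I_add)
      finally show ?thesis .
    next
      case r
      have ac: "\<alpha> x \<in> carrier R"
        using \<alpha> r by blast
      have "h c = \<alpha> x \<odot>\<^bsub>M\<^esub> (m \<oplus>\<^bsub>M\<^esub> n) \<ominus>\<^bsub>M\<^esub> \<alpha> x \<odot>\<^bsub>M\<^esub> m \<ominus>\<^bsub>M\<^esub> \<alpha> x \<odot>\<^bsub>M\<^esub> n"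
        using r by (simp add: h_diff hf fc dc)
      also have "\<dots> = \<alpha> x \<odot>\<^bsub>M\<^esub> (m \<oplus>\<^bsub>M\<^esub> n) \<oplus>\<^bsub>M\<^esub> \<ominus>\<^bsub>M\<^esub> (\<alpha> x \<odot>\<^bsub>M\<^esub> (m \<oplus>\<^bsub>M\<^esub> n))"
        using r ac smult_closed
        by (simp add: smult_r_distr a_minus_def M.minus_add M.a_assoc del: M.r_neg)
      also have "\<dots> = \<zero>\<^bsub>M\<^esub>"
        using r ac smult_closed by (simp add: M.r_neg)
      finally show ?thesis using Z.one_closed by simp
    next
      case b
      obtain \<beta> where \<beta>: "\<beta> \<in> carrier R" "x = p \<otimes> \<alpha> x \<oplus> q \<otimes> \<beta>"
        using \<alpha>[OF b(2)] by blast
      have ac: "\<alpha> x \<in> carrier R" "\<alpha> (x \<otimes> r) \<in> carrier R"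
        using \<alpha> b I_mult by blast+
      have "x \<otimes> r = p \<otimes> (\<alpha> x \<otimes> r) \<oplus> q \<otimes> (\<beta> \<otimes> r)"
        using mult_eq[of "\<alpha> x" \<beta> r] \<beta> ac b by simp
      then have "(\<alpha> x \<otimes> r) \<odot>\<^bsub>M\<^esub> m \<ominus>\<^bsub>M\<^esub> \<alpha> (x \<otimes> r) \<odot>\<^bsub>M\<^esub> m \<in> Z"
        by (rule \<alpha>_cong) (use b ac \<beta> in auto)
      then have "\<ominus>\<^bsub>M\<^esub> ((\<alpha> x \<otimes> r) \<odot>\<^bsub>M\<^esub> m \<ominus>\<^bsub>M\<^esub> \<alpha> (x \<otimes> r) \<odot>\<^bsub>M\<^esub> m) \<in> Z"
        by (rule Zneg)
      also have "\<ominus>\<^bsub>M\<^esub> ((\<alpha> x \<otimes> r) \<odot>\<^bsub>M\<^esub> m \<ominus>\<^bsub>M\<^esub> \<alpha> (x \<otimes> r) \<odot>\<^bsub>M\<^esub> m)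
        = \<alpha> (x \<otimes> r) \<odot>\<^bsub>M\<^esub> m \<ominus>\<^bsub>M\<^esub> \<alpha> x \<odot>\<^bsub>M\<^esub> (r \<odot>\<^bsub>M\<^esub> m)"
        using ac b smult_closed
        by (simp add: smult_assoc a_minus_def M.minus_add M.a_ac)
      also have "\<dots> = h c"
        using b smult_closed by (simp add: h_diff hf fc dc I_mult)
      finally show ?thesis .
    qed
  qed
  have h_ker: "h c \<in> Z" if "c \<in> generate FA (tensor_relators R A M)" for c
    using that
  proof induction
    case one
    show ?case using Z.one_closed by simp
  next
    case (incl c)
    then show ?case by (rule h_rel)
  next
    case (inv c)
    then show ?case
      using Zneg[OF h_rel[OF inv]] h.hom_inv[of c] relA by (auto simp: a_inv_def)
  next
    case (eng c d)
    then show ?case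
      using Zadd FA.generate_in_carrier[OF relA] h.hom_mult by simp
  qed
  (* The element \<open>p\<close> also has the coordinate \<open>1\<close>, and \<open>q\<close> also has the coordinate \<open>0\<close>. *)
  have pa: "u \<ominus>\<^bsub>M\<^esub> \<alpha> p \<odot>\<^bsub>M\<^esub> u \<in> Z"
    using \<alpha>_cong[of p \<one> \<zero> u] p q u by (simp add: smult_one)
  have qa: "\<zero> \<odot>\<^bsub>M\<^esub> w \<ominus>\<^bsub>M\<^esub> \<alpha> q \<odot>\<^bsub>M\<^esub> w \<in> Z"
    using \<alpha>_cong[of q \<zero> \<one> w] p q w by simp
  have ac: "\<alpha> p \<in> carrier R" "\<alpha> q \<in> carrier R"
    using \<alpha> pI qI by blast+
  have "\<alpha> p \<odot>\<^bsub>M\<^esub> u \<oplus>\<^bsub>M\<^esub> \<alpha> q \<odot>\<^bsub>M\<^esub> w = h t"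
    using h.hom_mult[of "frag_of (p, u)" "frag_of (q, w)"] pI qI u w
    by (simp add: t_def hf FA)
  moreover have "h t \<in> Z"
    using h_ker tKA by (simp add: KA_def tensor_kernel_def FA_def)
  ultimately have s: "\<alpha> p \<odot>\<^bsub>M\<^esub> u \<oplus>\<^bsub>M\<^esub> \<alpha> q \<odot>\<^bsub>M\<^esub> w \<in> Z"
    by simp
  have cl: "\<alpha> p \<odot>\<^bsub>M\<^esub> u \<in> carrier M" "\<alpha> q \<odot>\<^bsub>M\<^esub> w \<in> carrier M"
    using ac u w smult_closed by auto
  have "\<alpha> q \<odot>\<^bsub>M\<^esub> w \<in> Z"
    using Zneg[OF qa] cl w by (simp add: smult_l_null a_minus_def)
  from Zadd[OF s Zneg[OF this]] have "\<alpha> p \<odot>\<^bsub>M\<^esub> u \<in> Z"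
    using cl by (simp add: M.a_assoc M.r_neg)
  from Zadd[OF pa this] show ?thesis
    using cl u by (simp add: a_minus_def M.a_assoc M.l_neg)
qed


section \<open>The Hilbert space of a group\<close>

lemma ell2_memD: "\<xi> \<in> ell2 G \<Longrightarrow> g \<notin> carrier G \<Longrightarrow> \<xi> g = 0"
  by (simp add: ell2_def)

lemma L2_set_le_ell2_norm:
  assumes "\<xi> \<in> ell2 G" and "finite F" and "F \<subseteq> carrier G"
  shows "L2_set (\<lambda>g. cmod (\<xi> g)) F \<le> ell2_norm G \<xi>"
  unfolding L2_set_def ell2_norm_def
  by (rule real_sqrt_le_mono, rule finite_sum_le_infsum) (use assms in \<open>auto simp: ell2_def\<close>)

lemma ell2_norm_nonneg: "0 \<le> ell2_norm G \<xi>"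
  by (simp add: ell2_norm_def infsum_nonneg)

text \<open>
  With the previous bound this makes the norm the supremum of the Euclidean norms over finite sets,
  so the inequalities below reduce to finite sums.
\<close>

lemma ell2_bounded_partial:
  assumes "\<And>g. g \<notin> carrier G \<Longrightarrow> \<xi> g = 0"
    and bd: "\<And>F. finite F \<Longrightarrow> F \<subseteq> carrier G \<Longrightarrow> L2_set (\<lambda>g. cmod (\<xi> g)) F \<le> C"
  shows "\<xi> \<in> ell2 G" and "ell2_norm G \<xi> \<le> C"
proof -
  have C: "0 \<le> C"
    using bd[of "{}"] by simp
  have sums: "(\<Sum>g\<in>F. (cmod (\<xi> g))\<^sup>2) \<le> C\<^sup>2" if "finite F" "F \<subseteq> carrier G" for F
  proof -
    have "(sqrt (\<Sum>g\<in>F. (cmod (\<xi> g))\<^sup>2))\<^sup>2 \<le> C\<^sup>2"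
      using bd[OF that] by (intro power_mono) (auto simp: L2_set_def sum_nonneg)
    then show ?thesis
      by (simp add: sum_nonneg)
  qed
  have summable: "(\<lambda>g. (cmod (\<xi> g))\<^sup>2) summable_on carrier G"
    by (rule nonneg_bdd_above_summable_on) (use sums in \<open>auto simp: bdd_above_def\<close>)
  then show "\<xi> \<in> ell2 G"
    using assms(1) by (simp add: ell2_def)
  have "(\<Sum>\<^sub>\<infinity>g\<in>carrier G. (cmod (\<xi> g))\<^sup>2) \<le> C\<^sup>2"
    by (rule infsum_le_finite_sums[OF summable]) (use sums in auto)
  then show "ell2_norm G \<xi> \<le> C"
    unfolding ell2_norm_def using C by (metis real_sqrt_le_mono real_sqrt_unique)
qed

lemma cmod_le_ell2_norm:
  assumes "\<xi> \<in> ell2 G" shows "cmod (\<xi> g) \<le> ell2_norm G \<xi>"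
proof (cases "g \<in> carrier G")
  case True
  then show ?thesis
    using L2_set_le_ell2_norm[OF assms, of "{g}"] by (simp add: L2_set_def)
qed (use assms ell2_norm_nonneg in \<open>auto simp: ell2_def\<close>)

lemma ell2_zero [simp]: "(\<lambda>_. 0) \<in> ell2 G" "ell2_norm G (\<lambda>_. 0) = 0"
  by (auto simp: ell2_def ell2_norm_def)

lemma
  assumes "\<xi> \<in> ell2 G" and "\<eta> \<in> ell2 G"
  shows ell2_add: "(\<lambda>g. \<xi> g + \<eta> g) \<in> ell2 G"
    and ell2_norm_triangle: "ell2_norm G (\<lambda>g. \<xi> g + \<eta> g) \<le> ell2_norm G \<xi> + ell2_norm G \<eta>"
proof -
  have "L2_set (\<lambda>g. cmod (\<xi> g + \<eta> g)) F \<le> ell2_norm G \<xi> + ell2_norm G \<eta>"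
    if "finite F" "F \<subseteq> carrier G" for F
  proof -
    have "L2_set (\<lambda>g. cmod (\<xi> g + \<eta> g)) F \<le> L2_set (\<lambda>g. cmod (\<xi> g) + cmod (\<eta> g)) F"
      by (rule L2_set_mono) (auto intro: norm_triangle_ineq)
    also have "\<dots> \<le> L2_set (\<lambda>g. cmod (\<xi> g)) F + L2_set (\<lambda>g. cmod (\<eta> g)) F"
      by (rule L2_set_triangle_ineq)
    finally show ?thesis
      using L2_set_le_ell2_norm[OF assms(1) that] L2_set_le_ell2_norm[OF assms(2) that] by linarith
  qed
  from ell2_bounded_partial[where G = G, OF _ this]
  show "(\<lambda>g. \<xi> g + \<eta> g) \<in> ell2 G"
    and "ell2_norm G (\<lambda>g. \<xi> g + \<eta> g) \<le> ell2_norm G \<xi> + ell2_norm G \<eta>"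
    using assms by (auto simp: ell2_def)
qed

lemma
  assumes "\<xi> \<in> ell2 G"
  shows ell2_scale: "(\<lambda>g. c * \<xi> g) \<in> ell2 G"
    and ell2_norm_scale: "ell2_norm G (\<lambda>g. c * \<xi> g) \<le> cmod c * ell2_norm G \<xi>"
proof -
  have "L2_set (\<lambda>g. cmod (c * \<xi> g)) F \<le> cmod c * ell2_norm G \<xi>"
    if "finite F" "F \<subseteq> carrier G" for F
  proof -
    have "L2_set (\<lambda>g. cmod (c * \<xi> g)) F = cmod c * L2_set (\<lambda>g. cmod (\<xi> g)) F"
      by (simp add: L2_set_right_distrib norm_mult)
    then show ?thesis
      using L2_set_le_ell2_norm[OF assms(1) that] by (simp add: mult_left_mono)
  qed
  from ell2_bounded_partial[where G = G, OF _ this]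
  show "(\<lambda>g. c * \<xi> g) \<in> ell2 G" and "ell2_norm G (\<lambda>g. c * \<xi> g) \<le> cmod c * ell2_norm G \<xi>"
    using assms by (auto simp: ell2_def)
qed

lemma
  assumes "finite S" and "\<And>i. i \<in> S \<Longrightarrow> f i \<in> ell2 G"
  shows ell2_sum: "(\<lambda>g. \<Sum>i\<in>S. f i g) \<in> ell2 G"
    and ell2_norm_sum: "ell2_norm G (\<lambda>g. \<Sum>i\<in>S. f i g) \<le> (\<Sum>i\<in>S. ell2_norm G (f i))"
proof -
  have "(\<lambda>g. \<Sum>i\<in>S. f i g) \<in> ell2 G \<and>
        ell2_norm G (\<lambda>g. \<Sum>i\<in>S. f i g) \<le> (\<Sum>i\<in>S. ell2_norm G (f i))"
    using assms
  proof (induction S)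
    case (insert i S)
    then show ?case
      using ell2_add[of "f i" G "\<lambda>g. \<Sum>i\<in>S. f i g"]
        ell2_norm_triangle[of "f i" G "\<lambda>g. \<Sum>i\<in>S. f i g"] by force
  qed auto
  then show "(\<lambda>g. \<Sum>i\<in>S. f i g) \<in> ell2 G"
    and "ell2_norm G (\<lambda>g. \<Sum>i\<in>S. f i g) \<le> (\<Sum>i\<in>S. ell2_norm G (f i))" by auto
qed

lemma ell2_diff: "\<xi> \<in> ell2 G \<Longrightarrow> \<eta> \<in> ell2 G \<Longrightarrow> (\<lambda>g. \<xi> g - \<eta> g) \<in> ell2 G"
  using ell2_add[of \<xi> G "\<lambda>g. (-1) * \<eta> g"] ell2_scale[of \<eta> G "-1"] by simp

lemma ell2_dist_self [simp]: "ell2_dist G \<xi> \<xi> = 0"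
  by (simp add: ell2_dist_def)

lemma ell2_dist_triangle:
  assumes "\<xi> \<in> ell2 G" "\<eta> \<in> ell2 G" "\<zeta> \<in> ell2 G"
  shows "ell2_dist G \<xi> \<zeta> \<le> ell2_dist G \<xi> \<eta> + ell2_dist G \<eta> \<zeta>"
  using ell2_norm_triangle[OF ell2_diff[OF assms(1,2)] ell2_diff[OF assms(2,3)]]
  by (simp add: ell2_dist_def)

lemma
  assumes "\<xi> \<in> ell2 G" and inj: "inj_on \<phi> (carrier G)" and cl: "\<phi> ` carrier G \<subseteq> carrier G"
  shows ell2_reindex: "(\<lambda>g. if g \<in> carrier G then \<xi> (\<phi> g) else 0) \<in> ell2 G"
    and ell2_norm_reindex:
      "ell2_norm G (\<lambda>g. if g \<in> carrier G then \<xi> (\<phi> g) else 0) \<le> ell2_norm G \<xi>"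
proof -
  have "L2_set (\<lambda>g. cmod (if g \<in> carrier G then \<xi> (\<phi> g) else 0)) F \<le> ell2_norm G \<xi>"
    if F: "finite F" "F \<subseteq> carrier G" for F
  proof -
    have "L2_set (\<lambda>g. cmod (if g \<in> carrier G then \<xi> (\<phi> g) else 0)) F
          = L2_set (\<lambda>g. cmod (\<xi> (\<phi> g))) F"
      by (rule L2_set_cong) (use F in auto)
    also have "\<dots> = L2_set (\<lambda>g. cmod (\<xi> g)) (\<phi> ` F)"
      unfolding L2_set_def by (subst sum.reindex) (use inj F in \<open>auto intro: inj_on_subset\<close>)
    also have "\<dots> \<le> ell2_norm G \<xi>"
      by (rule L2_set_le_ell2_norm[OF assms(1)]) (use F cl in auto)
    finally show ?thesis .
  qed
  from ell2_bounded_partial[where G = G, OF _ this]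
  show "(\<lambda>g. if g \<in> carrier G then \<xi> (\<phi> g) else 0) \<in> ell2 G"
    and "ell2_norm G (\<lambda>g. if g \<in> carrier G then \<xi> (\<phi> g) else 0) \<le> ell2_norm G \<xi>"
    by auto
qed

lemma ell2_finite_approx:
  assumes "\<xi> \<in> ell2 G" and "\<epsilon> > 0"
  obtains F where "finite F" "F \<subseteq> carrier G"
    "ell2_dist G \<xi> (\<lambda>g. if g \<in> F then \<xi> g else 0) \<le> \<epsilon>"
proof -
  let ?f = "\<lambda>g. (cmod (\<xi> g))\<^sup>2"
  have summable: "?f summable_on carrier G"
    using assms(1) by (simp add: ell2_def)
  have "(sum ?f \<longlongrightarrow> infsum ?f (carrier G)) (finite_subsets_at_top (carrier G))"
    using summable by (rule infsum_tendsto)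
  then have "\<forall>\<^sub>F F in finite_subsets_at_top (carrier G). dist (sum ?f F) (infsum ?f (carrier G)) < \<epsilon>\<^sup>2"
    using assms(2) by (intro tendstoD) auto
  then obtain F where F: "finite F" "F \<subseteq> carrier G"
    and close: "dist (sum ?f F) (infsum ?f (carrier G)) < \<epsilon>\<^sup>2"
    unfolding eventually_finite_subsets_at_top by blast
  let ?\<rho> = "\<lambda>g. \<xi> g - (if g \<in> F then \<xi> g else 0)"
  have "L2_set (\<lambda>g. cmod (?\<rho> g)) E \<le> \<epsilon>" if E: "finite E" "E \<subseteq> carrier G" for E
  proof -
    have "(\<Sum>g\<in>E. (cmod (?\<rho> g))\<^sup>2) = (\<Sum>g\<in>E - F. ?f g)"
      by (rule sum.mono_neutral_cong_right) (use E in auto)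
    moreover have "(\<Sum>g\<in>E - F. ?f g) + sum ?f F = sum ?f ((E - F) \<union> F)"
      by (rule sum.union_disjoint[symmetric]) (use E F in auto)
    moreover have "sum ?f ((E - F) \<union> F) \<le> infsum ?f (carrier G)"
      by (rule finite_sum_le_infsum[OF summable]) (use E F in auto)
    ultimately have "(\<Sum>g\<in>E. (cmod (?\<rho> g))\<^sup>2) \<le> \<epsilon>\<^sup>2"
      using close by (simp add: dist_real_def)
    then have "sqrt (\<Sum>g\<in>E. (cmod (?\<rho> g))\<^sup>2) \<le> sqrt (\<epsilon>\<^sup>2)"
      by (rule real_sqrt_le_mono)
    then show ?thesis
      using assms(2) by (simp add: L2_set_def)
  qed
  from ell2_bounded_partial(2)[where G = G, OF _ this]
  have "ell2_norm G ?\<rho> \<le> \<epsilon>"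
    using assms(1) F by (auto simp: ell2_def)
  then show thesis
    using F that by (simp add: ell2_dist_def)
qed


section \<open>Point masses and convolution\<close>

definition point_mass :: "'g \<Rightarrow> 'g \<Rightarrow> complex" where
  "point_mass g = (\<lambda>h. if h = g then 1 else 0)"

lemma
  fixes G :: "('g, 'm) monoid_scheme"
  assumes "g \<in> carrier G"
  shows point_mass_group_algebra: "point_mass g \<in> carrier (group_algebra G)"
    and point_mass_ell2: "point_mass g \<in> ell2 G"
proof -
  show "point_mass g \<in> carrier (group_algebra G)"
    using assms by (auto simp: point_mass_def group_algebra_def)
  have "L2_set (\<lambda>h. cmod (point_mass g h)) F \<le> 1" if "finite F" for F :: "'g set"
  proof -
    have "(\<Sum>h\<in>F. (cmod (point_mass g h))\<^sup>2) = (\<Sum>h\<in>F \<inter> {g}. 1)"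
      by (rule sum.mono_neutral_cong_right) (use that in \<open>auto simp: point_mass_def\<close>)
    also have "\<dots> \<le> (1::real)"
      using card_mono[of "{g}" "F \<inter> {g}"] by simp
    finally show ?thesis
      by (simp add: L2_set_def)
  qed
  from ell2_bounded_partial(1)[where G = G, OF _ this] show "point_mass g \<in> ell2 G"
    using assms unfolding point_mass_def by metis
qed

text \<open>
  The point masses are orthonormal, so averages of many of them tend to zero.  The density of
  the domains of the quotients by \<open>x - 1\<close> rests on this.
\<close>

lemma ell2_norm_average_le:
  fixes \<gamma> :: "nat \<Rightarrow> 'g" and G :: "('g, 'm) monoid_scheme"
  assumes inj: "inj_on \<gamma> {..<N}" and cl: "\<And>i. i < N \<Longrightarrow> \<gamma> i \<in> carrier G" and "N > 0"
  shows "ell2_norm G (\<lambda>h. \<Sum>i<N. point_mass (\<gamma> i) h / of_nat N) \<le> 1 / sqrt N"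
proof (rule ell2_bounded_partial(2))
  fix F assume F: "finite F" "F \<subseteq> carrier G"
  let ?f = "\<lambda>h. \<Sum>i<N. point_mass (\<gamma> i) h / of_nat N :: complex"
  have val: "?f h = (if h \<in> \<gamma> ` {..<N} then 1 / of_nat N else 0)" for h
  proof (cases "h \<in> \<gamma> ` {..<N}")
    case True
    then obtain j where j: "j < N" "h = \<gamma> j" by auto
    have "?f h = (\<Sum>i<N. if i = j then 1 / of_nat N else 0)"
      by (rule sum.cong) (use j inj in \<open>auto simp: point_mass_def inj_on_def\<close>)
    then show ?thesis
      using j True by simp
  next
    case False
    then show ?thesis
      by (auto simp: point_mass_def intro!: sum.neutral)
  qed
  have "(\<Sum>h\<in>F. (cmod (?f h))\<^sup>2) = (\<Sum>h\<in>F \<inter> \<gamma> ` {..<N}. (1 / real N)\<^sup>2)"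
    unfolding val by (rule sum.mono_neutral_cong_right) (use F in \<open>auto simp: norm_divide\<close>)
  also have "\<dots> = card (F \<inter> \<gamma> ` {..<N}) * (1 / real N)\<^sup>2"
    by simp
  also have "\<dots> \<le> N * (1 / real N)\<^sup>2"
    using card_mono[of "\<gamma> ` {..<N}" "F \<inter> \<gamma> ` {..<N}"] card_image_le[of "{..<N}" \<gamma>]
    by (intro mult_right_mono) auto
  also have "\<dots> = 1 / N"
    using \<open>N > 0\<close> by (simp add: power2_eq_square)
  finally show "L2_set (\<lambda>h. cmod (?f h)) F \<le> 1 / sqrt N"
    unfolding L2_set_def by (metis real_sqrt_le_mono real_sqrt_divide real_sqrt_one)
qed (use cl in \<open>auto simp: point_mass_def intro!: sum.neutral\<close>)

lemma convolve_on:
  assumes "finite F" and "F \<subseteq> carrier G" and "{h \<in> carrier G. a h \<noteq> 0} \<subseteq> F"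
  shows "convolve G a \<xi> g =
         (if g \<in> carrier G then \<Sum>h\<in>F. a h * \<xi> (inv\<^bsub>G\<^esub> h \<otimes>\<^bsub>G\<^esub> g) else 0)"
proof -
  have "(\<Sum>h\<in>{h \<in> carrier G. a h \<noteq> 0}. a h * \<xi> (inv\<^bsub>G\<^esub> h \<otimes>\<^bsub>G\<^esub> g)) =
        (\<Sum>h\<in>F. a h * \<xi> (inv\<^bsub>G\<^esub> h \<otimes>\<^bsub>G\<^esub> g))"
    by (rule sum.mono_neutral_left) (use assms in auto)
  then show ?thesis
    by (simp add: convolve_def)
qed

lemma group_algebra_finite_support:
  "\<alpha> \<in> carrier (group_algebra G) \<Longrightarrow> finite {h \<in> carrier G. \<alpha> h \<noteq> 0}"
  by (simp add: group_algebra_def)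

lemma convolve_add: "convolve G a (\<lambda>g. \<xi> g + \<eta> g) = (\<lambda>g. convolve G a \<xi> g + convolve G a \<eta> g)"
  by (simp add: convolve_def fun_eq_iff sum.distrib distrib_left)

lemma convolve_scale: "convolve G a (\<lambda>g. c * \<xi> g) = (\<lambda>g. c * convolve G a \<xi> g)"
  by (simp add: convolve_def fun_eq_iff sum_distrib_left mult.left_commute)

lemma convolve_zero: "convolve G a (\<lambda>g. 0) = (\<lambda>g. 0)"
  by (simp add: convolve_def fun_eq_iff)

lemma convolve_diff: "convolve G a (\<lambda>g. \<xi> g - \<eta> g) = (\<lambda>g. convolve G a \<xi> g - convolve G a \<eta> g)"
  using convolve_add[of G a \<xi> "\<lambda>g. (-1) * \<eta> g"] convolve_scale[of G a "-1" \<eta>] by simp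

lemma (in group)
  assumes "\<alpha> \<in> carrier (group_algebra G)" and "\<xi> \<in> ell2 G"
  shows convolve_ell2: "convolve G \<alpha> \<xi> \<in> ell2 G"
    and ell2_norm_convolve:
      "ell2_norm G (convolve G \<alpha> \<xi>) \<le> (\<Sum>h\<in>{h \<in> carrier G. \<alpha> h \<noteq> 0}. cmod (\<alpha> h)) * ell2_norm G \<xi>"
proof -
  let ?S = "{h \<in> carrier G. \<alpha> h \<noteq> 0}"
  let ?t = "\<lambda>h g. if g \<in> carrier G then \<xi> (inv h \<otimes> g) else 0"
  have fin: "finite ?S"
    using assms(1) by (rule group_algebra_finite_support)
  have eq: "convolve G \<alpha> \<xi> = (\<lambda>g. \<Sum>h\<in>?S. \<alpha> h * ?t h g)"
    by (auto simp: convolve_def)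
  have inj: "inj_on (\<lambda>g. inv h \<otimes> g) (carrier G)" and cl: "(\<lambda>g. inv h \<otimes> g) ` carrier G \<subseteq> carrier G"
    if "h \<in> ?S" for h
    using that by (auto simp: inj_on_def)
  have t: "?t h \<in> ell2 G" "ell2_norm G (?t h) \<le> ell2_norm G \<xi>" if "h \<in> ?S" for h
    using ell2_reindex[OF assms(2) inj[OF that] cl[OF that]]
      ell2_norm_reindex[OF assms(2) inj[OF that] cl[OF that]] by auto
  show "convolve G \<alpha> \<xi> \<in> ell2 G"
    unfolding eq by (rule ell2_sum[OF fin]) (rule ell2_scale[OF t(1)])
  have "ell2_norm G (convolve G \<alpha> \<xi>) \<le> (\<Sum>h\<in>?S. ell2_norm G (\<lambda>g. \<alpha> h * ?t h g))"
    unfolding eq by (rule ell2_norm_sum[OF fin]) (rule ell2_scale[OF t(1)])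
  also have "\<dots> \<le> (\<Sum>h\<in>?S. cmod (\<alpha> h) * ell2_norm G \<xi>)"
    using ell2_norm_scale[OF t(1)] t(2)
    by (intro sum_mono) (meson mult_left_mono norm_ge_zero order_trans)
  finally show "ell2_norm G (convolve G \<alpha> \<xi>) \<le> (\<Sum>h\<in>?S. cmod (\<alpha> h)) * ell2_norm G \<xi>"
    by (simp add: sum_distrib_right)
qed

lemma (in group) convolve_right_translate:
  assumes "k \<in> carrier G"
  shows "convolve G \<alpha> (\<lambda>h. if h \<in> carrier G then \<xi> (h \<otimes> k) else 0) =
         (\<lambda>h. if h \<in> carrier G then convolve G \<alpha> \<xi> (h \<otimes> k) else 0)"
  using assms by (auto simp: convolve_def fun_eq_iff m_assoc intro!: sum.cong)

lemma convolve_diff_left: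
  assumes "\<alpha> \<in> carrier (group_algebra G)" "\<beta> \<in> carrier (group_algebra G)"
  shows "convolve G (\<lambda>g. \<alpha> g - \<beta> g) \<xi> = (\<lambda>g. convolve G \<alpha> \<xi> g - convolve G \<beta> \<xi> g)"
proof
  fix g
  let ?F = "{h \<in> carrier G. \<alpha> h \<noteq> 0} \<union> {h \<in> carrier G. \<beta> h \<noteq> 0}"
  have F: "finite ?F" "?F \<subseteq> carrier G"
    using assms by (auto simp: group_algebra_def)
  have on: "convolve G \<gamma> \<xi> g = (if g \<in> carrier G then \<Sum>h\<in>?F. \<gamma> h * \<xi> (inv\<^bsub>G\<^esub> h \<otimes>\<^bsub>G\<^esub> g) else 0)"
    if "\<And>h. h \<in> carrier G \<Longrightarrow> \<gamma> h \<noteq> 0 \<Longrightarrow> h \<in> ?F" for \<gamma>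
    by (rule convolve_on[OF F]) (use that in blast)
  have "convolve G (\<lambda>g. \<alpha> g - \<beta> g) \<xi> g =
        (if g \<in> carrier G then \<Sum>h\<in>?F. (\<alpha> h - \<beta> h) * \<xi> (inv\<^bsub>G\<^esub> h \<otimes>\<^bsub>G\<^esub> g) else 0)"
    by (rule on) auto
  also have "\<dots> = (if g \<in> carrier G then \<Sum>h\<in>?F. \<alpha> h * \<xi> (inv\<^bsub>G\<^esub> h \<otimes>\<^bsub>G\<^esub> g) else 0) -
                  (if g \<in> carrier G then \<Sum>h\<in>?F. \<beta> h * \<xi> (inv\<^bsub>G\<^esub> h \<otimes>\<^bsub>G\<^esub> g) else 0)"
    by (simp only: left_diff_distrib sum_subtractf diff_zero split: if_split) simp
  also have "(if g \<in> carrier G then \<Sum>h\<in>?F. \<alpha> h * \<xi> (inv\<^bsub>G\<^esub> h \<otimes>\<^bsub>G\<^esub> g) else 0) = convolve G \<alpha> \<xi> g"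
    by (rule on[symmetric]) auto
  also have "(if g \<in> carrier G then \<Sum>h\<in>?F. \<beta> h * \<xi> (inv\<^bsub>G\<^esub> h \<otimes>\<^bsub>G\<^esub> g) else 0) = convolve G \<beta> \<xi> g"
    by (rule on[symmetric]) auto
  finally show "convolve G (\<lambda>g. \<alpha> g - \<beta> g) \<xi> g = convolve G \<alpha> \<xi> g - convolve G \<beta> \<xi> g" .
qed

lemma convolve_sum:
  "convolve G \<alpha> (\<lambda>g. \<Sum>i\<in>I. f i g) = (\<lambda>g. \<Sum>i\<in>I. convolve G \<alpha> (f i) g)"
proof (induction I rule: infinite_finite_induct)
  case (insert i I)
  then show ?case
    using convolve_add[of G \<alpha> "f i" "\<lambda>g. \<Sum>i\<in>I. f i g"] by (simp add: fun_eq_iff)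
qed (simp_all add: convolve_zero)

lemma group_algebra_diff:
  assumes "\<alpha> \<in> carrier (group_algebra G)" "\<beta> \<in> carrier (group_algebra G)"
  shows "(\<lambda>g. \<alpha> g - \<beta> g) \<in> carrier (group_algebra G)"
proof -
  have "{g. \<alpha> g - \<beta> g \<noteq> 0} \<subseteq> {g. \<alpha> g \<noteq> 0} \<union> {g. \<beta> g \<noteq> 0}"
    by auto
  then show ?thesis
    using assms finite_subset by (auto simp: group_algebra_def)
qed


section \<open>Operators defined by equations in the group algebra\<close>

text \<open>
  For injective \<open>p\<close> this is the operator \<open>p\<^sup>-\<^sup>1 q\<close>.  It is given by the equation \<open>p \<eta> = q \<xi>\<close> and not as a product because the graph
  of the equation is closed from the outset.
\<close>

definition quotient_operator ::
  "('g, 'm) monoid_scheme \<Rightarrow> ('g \<Rightarrow> complex) \<Rightarrow> ('g \<Rightarrow> complex) \<Rightarrow> 'g operator"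
where
  "quotient_operator G p q =
     {(\<xi>, \<eta>) \<in> ell2 G \<times> ell2 G. convolve G p \<eta> = convolve G q \<xi>}"

definition regular_on_ell2 :: "('g, 'm) monoid_scheme \<Rightarrow> ('g \<Rightarrow> complex) \<Rightarrow> bool" where
  "regular_on_ell2 G p \<longleftrightarrow>
     p \<in> carrier (group_algebra G) \<and>
     (\<forall>\<xi>\<in>ell2 G. convolve G p \<xi> = (\<lambda>_. 0) \<longrightarrow> \<xi> = (\<lambda>_. 0))"

lemma regular_on_ell2_cancel:
  assumes "regular_on_ell2 G p" "\<xi> \<in> ell2 G" "\<eta> \<in> ell2 G" "convolve G p \<xi> = convolve G p \<eta>"
  shows "\<xi> = \<eta>"
proof -
  have "convolve G p (\<lambda>g. \<xi> g - \<eta> g) = (\<lambda>_. 0)"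
    using assms(4) by (simp add: convolve_diff)
  then have "(\<lambda>g. \<xi> g - \<eta> g) = (\<lambda>_. 0)"
    using assms ell2_diff[OF assms(2,3)] by (simp add: regular_on_ell2_def)
  then show ?thesis
    by (simp add: fun_eq_iff)
qed

lemma operator_closure_superset:
  assumes "T \<subseteq> ell2 G \<times> ell2 G" shows "T \<subseteq> operator_closure G T"
proof
  fix z assume z: "z \<in> T"
  obtain \<xi> \<eta> where "z = (\<xi>, \<eta>)" by fastforce
  with z assms show "z \<in> operator_closure G T"
    unfolding operator_closure_def by (auto intro!: bexI[of _ z])
qed

lemma operator_closure_mono: "S \<subseteq> T \<Longrightarrow> operator_closure G S \<subseteq> operator_closure G T"
  unfolding operator_closure_def by fast

lemma linear_operator_add:
  assumes "linear_operator G T" "(\<xi>, \<eta>) \<in> T" "(\<xi>', \<eta>') \<in> T"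
  shows "(\<lambda>g. \<xi> g + \<xi>' g, \<lambda>g. \<eta> g + \<eta>' g) \<in> T"
  using assms unfolding linear_operator_def by blast

lemma linear_operator_scale:
  assumes "linear_operator G T" "(\<xi>, \<eta>) \<in> T"
  shows "(\<lambda>g. c * \<xi> g, \<lambda>g. c * \<eta> g) \<in> T"
  using assms unfolding linear_operator_def by blast

lemma Domain_sum:
  assumes T: "linear_operator G T" and "finite S" and "\<And>i. i \<in> S \<Longrightarrow> f i \<in> Domain T"
  shows "(\<lambda>g. \<Sum>i\<in>S. f i g) \<in> Domain T"
  using assms(2,3)
proof (induction S)
  case empty
  then show ?case
    using T by (auto simp: linear_operator_def)
next
  case (insert i S)
  then obtain \<eta> \<zeta> where "(f i, \<eta>) \<in> T" "(\<lambda>g. \<Sum>i\<in>S. f i g, \<zeta>) \<in> T"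
    by blast
  then have "(\<lambda>g. f i g + (\<Sum>i\<in>S. f i g), \<lambda>g. \<eta> g + \<zeta> g) \<in> T"
    by (rule linear_operator_add[OF T])
  then show ?case
    using insert.hyps by (simp add: Domain.DomainI)
qed

lemma Domain_scale:
  assumes "linear_operator G T" "\<xi> \<in> Domain T" shows "(\<lambda>g. c * \<xi> g) \<in> Domain T"
  using assms(2) linear_operator_scale[OF assms(1)] by blast

context group
begin

lemma convolve_point_mass:
  assumes "k \<in> carrier G"
  shows "convolve G (point_mass k) \<xi> = (\<lambda>g. if g \<in> carrier G then \<xi> (inv k \<otimes> g) else 0)"
proof
  fix g
  show "convolve G (point_mass k) \<xi> g = (if g \<in> carrier G then \<xi> (inv k \<otimes> g) else 0)"
    by (subst convolve_on[where F = "{k}"]) (use assms in \<open>auto simp: point_mass_def\<close>)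
qed

lemma convolve_one:
  assumes "\<xi> \<in> ell2 G" shows "convolve G (point_mass \<one>) \<xi> = \<xi>"
  using ell2_memD[OF assms] by (auto simp: convolve_point_mass)

lemma left_multiplication_in_group_von_Neumann:
  assumes \<alpha>: "\<alpha> \<in> carrier (group_algebra G)"
  shows "left_multiplication G \<alpha> \<in> group_von_Neumann G"
proof -
  let ?L = "left_multiplication G \<alpha>"
  have lin: "linear_operator G ?L"
    unfolding linear_operator_def left_multiplication_def
    using convolve_ell2[OF \<alpha>] ell2_add ell2_scale convolve_zero[of G \<alpha>]
    by (auto simp: single_valued_def convolve_add convolve_scale)
  have dom: "Domain ?L = ell2 G"
    by (auto simp: left_multiplication_def)
  have bdd: "\<exists>C. \<forall>(\<xi>, \<eta>)\<in>?L. ell2_norm G \<eta> \<le> C * ell2_norm G \<xi>"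
    using ell2_norm_convolve[OF \<alpha>] by (auto simp: left_multiplication_def)
  have "?L O right_translation G k = right_translation G k O ?L" if k: "k \<in> carrier G" for k
  proof -
    have inj: "inj_on (\<lambda>h. h \<otimes> k) (carrier G)" "(\<lambda>h. h \<otimes> k) ` carrier G \<subseteq> carrier G"
      using k by (auto simp: inj_on_def)
    show ?thesis
      unfolding left_multiplication_def right_translation_def
      using ell2_reindex[OF _ inj] convolve_ell2[OF \<alpha>]
      by (auto simp: convolve_right_translate[OF k] relcomp_unfold)
  qed
  then show ?thesis
    using lin dom bdd by (simp add: group_von_Neumann_def bounded_operator_def)
qed

text \<open>
  Left multiplications belong to the group von Neumann algebra, so its commutant preserves every
  equation between them; this is why quotient operators are affiliated.
\<close>

lemma commutant_convolve:
  assumes W: "W \<in> commutant G (group_von_Neumann G)"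
    and \<alpha>: "\<alpha> \<in> carrier (group_algebra G)" and "(\<xi>, \<eta>) \<in> W"
  shows "(convolve G \<alpha> \<xi>, convolve G \<alpha> \<eta>) \<in> W"
proof -
  have sub: "W \<subseteq> ell2 G \<times> ell2 G"
    using W by (auto simp: commutant_def bounded_operator_def linear_operator_def)
  have comm: "left_multiplication G \<alpha> O W = W O left_multiplication G \<alpha>"
    using W left_multiplication_in_group_von_Neumann[OF \<alpha>] by (simp add: commutant_def)
  have "(\<xi>, convolve G \<alpha> \<eta>) \<in> W O left_multiplication G \<alpha>"
    using assms(3) sub by (auto simp: left_multiplication_def)
  then have "(\<xi>, convolve G \<alpha> \<eta>) \<in> left_multiplication G \<alpha> O W"
    by (simp only: comm)
  then show ?thesis
    by (auto simp: left_multiplication_def)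
qed

lemma quotient_operator_commutes:
  assumes W: "W \<in> commutant G (group_von_Neumann G)" and U: "unitary_operator G W"
    and p: "p \<in> carrier (group_algebra G)" and q: "q \<in> carrier (group_algebra G)"
  shows "quotient_operator G p q O W = W O quotient_operator G p q"
proof -
  have lin: "linear_operator G W" and dom: "Domain W = ell2 G" and ran: "Range W = ell2 G"
    and iso: "\<And>\<xi> \<eta>. (\<xi>, \<eta>) \<in> W \<Longrightarrow> ell2_norm G \<eta> = ell2_norm G \<xi>"
    using U by (auto simp: unitary_operator_def bounded_operator_def)
  have sub: "W \<subseteq> ell2 G \<times> ell2 G" and sv: "single_valued W"
    using lin by (auto simp: linear_operator_def)
  have inj: "\<xi> = \<xi>'" if "(\<xi>, \<eta>) \<in> W" "(\<xi>', \<eta>) \<in> W" for \<xi> \<xi>' \<eta>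
  proof -
    have "(\<lambda>g. (-1) * \<xi>' g, \<lambda>g. (-1) * \<eta> g) \<in> W"
      by (rule linear_operator_scale[OF lin that(2)])
    from linear_operator_add[OF lin that(1) this] have "(\<lambda>g. \<xi> g + (-1) * \<xi>' g, \<lambda>g. \<eta> g + (-1) * \<eta> g) \<in> W" .
    then have z: "(\<lambda>g. \<xi> g - \<xi>' g, \<lambda>g. 0) \<in> W"
      by simp
    then have "cmod (\<xi> g - \<xi>' g) \<le> 0" for g
      using iso[OF z] sub cmod_le_ell2_norm[of "\<lambda>g. \<xi> g - \<xi>' g" G g] by auto
    then show ?thesis
      by (simp add: fun_eq_iff)
  qed
  note cw = commutant_convolve[OF W]
  show ?thesis
  proof (intro subset_antisym subrelI)
    fix \<xi> \<zeta> assume "(\<xi>, \<zeta>) \<in> quotient_operator G p q O W"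
    then obtain \<eta> where e: "(\<xi>, \<eta>) \<in> quotient_operator G p q" "(\<eta>, \<zeta>) \<in> W" by blast
    then have "\<xi> \<in> ell2 G"
      by (simp add: quotient_operator_def)
    then obtain \<xi>' where x: "(\<xi>, \<xi>') \<in> W" using dom by blast
    have "convolve G p \<zeta> = convolve G q \<xi>'"
      using cw[OF p e(2)] cw[OF q x] e(1) sv
      by (auto simp: quotient_operator_def dest: single_valuedD)
    then show "(\<xi>, \<zeta>) \<in> W O quotient_operator G p q"
      using x e sub by (auto simp: quotient_operator_def)
  next
    fix \<xi> \<zeta> assume "(\<xi>, \<zeta>) \<in> W O quotient_operator G p q"
    then obtain \<xi>' where e: "(\<xi>, \<xi>') \<in> W" "(\<xi>', \<zeta>) \<in> quotient_operator G p q" by blast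
    then have "\<zeta> \<in> ell2 G"
      by (simp add: quotient_operator_def)
    then obtain \<eta> where x: "(\<eta>, \<zeta>) \<in> W" using ran by blast
    have "convolve G p \<eta> = convolve G q \<xi>"
      using cw[OF p x] cw[OF q e(1)] e(2) inj by (auto simp: quotient_operator_def)
    then show "(\<xi>, \<zeta>) \<in> quotient_operator G p q O W"
      using x e sub by (auto simp: quotient_operator_def)
  qed
qed

lemma quotient_operator_closed:
  assumes p: "p \<in> carrier (group_algebra G)" and q: "q \<in> carrier (group_algebra G)"
  shows "operator_closure G (quotient_operator G p q) = quotient_operator G p q"
proof
  show "quotient_operator G p q \<subseteq> operator_closure G (quotient_operator G p q)"
    by (rule operator_closure_superset) (auto simp: quotient_operator_def)
  show "operator_closure G (quotient_operator G p q) \<subseteq> quotient_operator G p q"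
  proof (rule subrelI)
    fix \<xi> \<eta> assume cl: "(\<xi>, \<eta>) \<in> operator_closure G (quotient_operator G p q)"
    then have mem: "\<xi> \<in> ell2 G" "\<eta> \<in> ell2 G"
      by (auto simp: operator_closure_def)
    define C where "C = (\<Sum>h\<in>{h \<in> carrier G. p h \<noteq> 0}. cmod (p h)) +
                        (\<Sum>h\<in>{h \<in> carrier G. q h \<noteq> 0}. cmod (q h))"
    have C: "C \<ge> 0"
      by (simp add: C_def sum_nonneg)
    have small: "cmod (convolve G p \<eta> g - convolve G q \<xi> g) \<le> C * \<epsilon>" if "\<epsilon> > 0" for g \<epsilon>
    proof -
      have "\<exists>(\<xi>', \<eta>')\<in>quotient_operator G p q. ell2_dist G \<xi> \<xi>' < \<epsilon> \<and> ell2_dist G \<eta> \<eta>' < \<epsilon>"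
        using cl that by (simp add: operator_closure_def)
      then obtain \<xi>' \<eta>' where near: "(\<xi>', \<eta>') \<in> quotient_operator G p q"
        "ell2_dist G \<xi> \<xi>' < \<epsilon>" "ell2_dist G \<eta> \<eta>' < \<epsilon>"
        by blast
      then have mem': "\<xi>' \<in> ell2 G" "\<eta>' \<in> ell2 G"
        and eq: "convolve G p \<eta>' g = convolve G q \<xi>' g"
        by (auto simp: quotient_operator_def)
      have d: "cmod (convolve G r \<zeta> g - convolve G r \<zeta>' g)
               \<le> (\<Sum>h\<in>{h \<in> carrier G. r h \<noteq> 0}. cmod (r h)) * \<epsilon>"
        if r: "r \<in> carrier (group_algebra G)" and z: "\<zeta> \<in> ell2 G" "\<zeta>' \<in> ell2 G"
          and "ell2_dist G \<zeta> \<zeta>' < \<epsilon>" for r \<zeta> \<zeta>'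
      proof -
        have "cmod (convolve G r (\<lambda>g. \<zeta> g - \<zeta>' g) g) \<le> ell2_norm G (convolve G r (\<lambda>g. \<zeta> g - \<zeta>' g))"
          by (rule cmod_le_ell2_norm[OF convolve_ell2[OF r ell2_diff[OF z]]])
        also have "\<dots> \<le> (\<Sum>h\<in>{h \<in> carrier G. r h \<noteq> 0}. cmod (r h)) * ell2_dist G \<zeta> \<zeta>'"
          unfolding ell2_dist_def by (rule ell2_norm_convolve[OF r ell2_diff[OF z]])
        also have "\<dots> \<le> (\<Sum>h\<in>{h \<in> carrier G. r h \<noteq> 0}. cmod (r h)) * \<epsilon>"
          using that by (intro mult_left_mono) (auto simp: sum_nonneg)
        finally show ?thesis
          by (simp add: convolve_diff)
      qed
      have "cmod (convolve G p \<eta> g - convolve G q \<xi> g)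
            \<le> cmod (convolve G p \<eta> g - convolve G p \<eta>' g) + cmod (convolve G q \<xi> g - convolve G q \<xi>' g)"
        using norm_triangle_ineq4[of "convolve G p \<eta> g - convolve G p \<eta>' g"
            "convolve G q \<xi> g - convolve G q \<xi>' g"] eq by (simp add: norm_minus_commute)
      then show ?thesis
        using d[OF p mem(2) mem'(2) near(3)] d[OF q mem(1) mem'(1) near(2)]
        by (simp add: C_def distrib_right)
    qed
    have "convolve G p \<eta> g = convolve G q \<xi> g" for g
    proof -
      have "cmod (convolve G p \<eta> g - convolve G q \<xi> g) \<le> e" if "e > 0" for e
      proof -
        have "C * (e / (C + 1)) \<le> e"
          using C that by (simp add: field_simps)
        then show ?thesis
          using small[of "e / (C + 1)" g] C that by simp
      qed
      then have "cmod (convolve G p \<eta> g - convolve G q \<xi> g) \<le> 0"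
        by (rule field_le_epsilon[where y = 0, simplified])
      then show ?thesis by simp
    qed
    then show "(\<xi>, \<eta>) \<in> quotient_operator G p q"
      using mem by (auto simp: quotient_operator_def)
  qed
qed

lemma quotient_operator_linear:
  assumes "regular_on_ell2 G p"
  shows "linear_operator G (quotient_operator G p q)"
  unfolding linear_operator_def
proof (intro conjI)
  show "single_valued (quotient_operator G p q)"
    using regular_on_ell2_cancel[OF assms] by (auto simp: single_valued_def quotient_operator_def)
qed (auto simp: quotient_operator_def convolve_zero convolve_add convolve_scale ell2_add ell2_scale)

text \<open>
  The domain of such an operator is stable under right translations, since left and right
  translations commute; so it is dense as soon as the point mass at the neutral element is a limit of
  its elements.
\<close>

lemma quotient_operator_dense:
  assumes reg: "regular_on_ell2 G p"
    and approx: "\<And>\<epsilon>. \<epsilon> > 0 \<Longrightarrow>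
        \<exists>r\<in>Domain (quotient_operator G p q). ell2_dist G (point_mass \<one>) r < \<epsilon>"
  shows "densely_defined G (quotient_operator G p q)"
  unfolding densely_defined_def
proof (intro ballI allI impI)
  let ?T = "quotient_operator G p q"
  have lin: "linear_operator G ?T"
    by (rule quotient_operator_linear[OF reg])
  fix \<xi> and \<epsilon> :: real
  assume \<xi>: "\<xi> \<in> ell2 G" and \<epsilon>: "\<epsilon> > 0"
  have dom_sub: "Domain ?T \<subseteq> ell2 G"
    by (auto simp: quotient_operator_def)
  have point: "\<exists>r\<in>Domain ?T. ell2_dist G (point_mass k) r < e"
    if k: "k \<in> carrier G" and e: "e > 0" for k and e :: real
  proof -
    obtain r s where rs: "(r, s) \<in> ?T" "ell2_dist G (point_mass \<one>) r < e"
      using approx[OF e] by blast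
    define \<rho> where "\<rho> \<zeta> = (\<lambda>h. if h \<in> carrier G then \<zeta> (h \<otimes> inv k) else 0)"
      for \<zeta> :: "'a \<Rightarrow> complex"
    have inj: "inj_on (\<lambda>h. h \<otimes> inv k) (carrier G)" "(\<lambda>h. h \<otimes> inv k) ` carrier G \<subseteq> carrier G"
      using k by (auto simp: inj_on_def)
    have \<rho>_ell2: "\<rho> \<zeta> \<in> ell2 G" if "\<zeta> \<in> ell2 G" for \<zeta>
      unfolding \<rho>_def by (rule ell2_reindex[OF that inj])
    have \<rho>_conv: "convolve G \<alpha> (\<rho> \<zeta>) = \<rho> (convolve G \<alpha> \<zeta>)" for \<alpha> \<zeta>
      unfolding \<rho>_def by (rule convolve_right_translate[OF inv_closed[OF k]])
    have "(\<rho> r, \<rho> s) \<in> ?T"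
      using rs(1) by (simp add: quotient_operator_def \<rho>_ell2 \<rho>_conv)
    moreover have "ell2_dist G (point_mass k) (\<rho> r) \<le> ell2_dist G (point_mass \<one>) r"
    proof -
      have eq: "(\<lambda>h. point_mass k h - \<rho> r h) = \<rho> (\<lambda>h. point_mass \<one> h - r h)"
        using k by (auto simp: \<rho>_def point_mass_def fun_eq_iff inv_solve_right')
      show ?thesis
        unfolding ell2_dist_def eq unfolding \<rho>_def
        by (rule ell2_norm_reindex[OF ell2_diff[OF point_mass_ell2] inj])
          (use rs in \<open>auto simp: quotient_operator_def\<close>)
    qed
    ultimately show ?thesis
      using rs(2) by force
  qed
  obtain F where F: "finite F" "F \<subseteq> carrier G"
    "ell2_dist G \<xi> (\<lambda>g. if g \<in> F then \<xi> g else 0) \<le> \<epsilon> / 2"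
    using ell2_finite_approx[OF \<xi>, of "\<epsilon> / 2"] \<epsilon> by auto
  define C where "C = (\<Sum>k\<in>F. cmod (\<xi> k)) + 1"
  have C: "C > 0"
    unfolding C_def by (simp add: add_nonneg_pos sum_nonneg)
  have "\<exists>r. r \<in> Domain ?T \<and> ell2_dist G (point_mass k) r < \<epsilon> / (2 * C)" if "k \<in> F" for k
  proof -
    have "k \<in> carrier G" "\<epsilon> / (2 * C) > 0"
      using that F(2) \<epsilon> C by auto
    from point[OF this] show ?thesis by blast
  qed
  then obtain r where r: "\<And>k. k \<in> F \<Longrightarrow> r k \<in> Domain ?T"
      "\<And>k. k \<in> F \<Longrightarrow> ell2_dist G (point_mass k) (r k) < \<epsilon> / (2 * C)"
    by metis
  define \<zeta> where "\<zeta> = (\<lambda>g. \<Sum>k\<in>F. \<xi> k * r k g)"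
  have \<zeta>: "\<zeta> \<in> Domain ?T"
    unfolding \<zeta>_def by (rule Domain_sum[OF lin F(1)]) (rule Domain_scale[OF lin r(1)])
  have fin_eq: "(if g \<in> F then \<xi> g else 0) = (\<Sum>k\<in>F. \<xi> k * point_mass k g)" for g
    using F(1) by (simp add: point_mass_def if_distrib[of "\<lambda>c. _ * c"] cong: if_cong)
  have diff_ell2: "(\<lambda>g. point_mass k g - r k g) \<in> ell2 G" if "k \<in> F" for k
    by (rule ell2_diff[OF point_mass_ell2]) (use that F(2) r(1)[OF that] dom_sub in auto)
  have "ell2_dist G (\<lambda>g. if g \<in> F then \<xi> g else 0) \<zeta>
        = ell2_norm G (\<lambda>g. \<Sum>k\<in>F. \<xi> k * (point_mass k g - r k g))"
    by (simp add: ell2_dist_def fin_eq \<zeta>_def right_diff_distrib sum_subtractf)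
  also have "\<dots> \<le> (\<Sum>k\<in>F. ell2_norm G (\<lambda>g. \<xi> k * (point_mass k g - r k g)))"
    by (rule ell2_norm_sum[OF F(1) ell2_scale[OF diff_ell2]])
  also have "\<dots> \<le> (\<Sum>k\<in>F. cmod (\<xi> k) * (\<epsilon> / (2 * C)))"
  proof (rule sum_mono)
    fix k assume k: "k \<in> F"
    have "ell2_norm G (\<lambda>g. \<xi> k * (point_mass k g - r k g))
          \<le> cmod (\<xi> k) * ell2_norm G (\<lambda>g. point_mass k g - r k g)"
      by (rule ell2_norm_scale[OF diff_ell2[OF k]])
    also have "\<dots> \<le> cmod (\<xi> k) * (\<epsilon> / (2 * C))"
      using r(2)[OF k] by (intro mult_left_mono) (auto simp: ell2_dist_def)
    finally show "ell2_norm G (\<lambda>g. \<xi> k * (point_mass k g - r k g)) \<le> cmod (\<xi> k) * (\<epsilon> / (2 * C))" .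
  qed
  also have "\<dots> = (\<Sum>k\<in>F. cmod (\<xi> k)) * (\<epsilon> / (2 * C))"
    by (rule sum_distrib_right[symmetric])
  also have "\<dots> = (C - 1) * (\<epsilon> / (2 * C))"
    by (simp add: C_def)
  also have "\<dots> < \<epsilon> / 2"
    using C \<epsilon> by (simp add: field_simps)
  finally have near: "ell2_dist G (\<lambda>g. if g \<in> F then \<xi> g else 0) \<zeta> < \<epsilon> / 2" .
  have "(\<lambda>g. if g \<in> F then \<xi> g else 0) \<in> ell2 G"
    unfolding fin_eq by (rule ell2_sum[OF F(1) ell2_scale[OF point_mass_ell2]]) (use F(2) in auto)
  then have "ell2_dist G \<xi> \<zeta> < \<epsilon>"
    using ell2_dist_triangle[OF \<xi>, of "\<lambda>g. if g \<in> F then \<xi> g else 0" \<zeta>] \<zeta> dom_sub F(3) near by auto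
  then show "\<exists>\<xi>'\<in>Domain ?T. ell2_dist G \<xi> \<xi>' < \<epsilon>"
    using \<zeta> by blast
qed

lemma quotient_operator_affiliated:
  assumes "regular_on_ell2 G p" and "q \<in> carrier (group_algebra G)"
    and "densely_defined G (quotient_operator G p q)"
  shows "quotient_operator G p q \<in> carrier (affiliated_ring G)"
  using assms quotient_operator_linear quotient_operator_closed quotient_operator_commutes
  by (simp add: affiliated_ring_def affiliated_def closed_operator_def regular_on_ell2_def)

lemma regular_on_ell2_one: "regular_on_ell2 G (point_mass \<one>)"
  by (simp add: regular_on_ell2_def convolve_one point_mass_group_algebra)

lemma left_multiplication_eq_quotient:
  assumes "q \<in> carrier (group_algebra G)"
  shows "left_multiplication G q = quotient_operator G (point_mass \<one>) q"
  using convolve_ell2[OF assms]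
  by (auto simp: left_multiplication_def quotient_operator_def convolve_one)

text \<open>
  The product of \<open>p\<close> and \<open>p\<^sup>-\<^sup>1 q\<close> is the restriction of the bounded operator \<open>q\<close> to a dense domain,
  and its closure is therefore \<open>q\<close>.
\<close>

lemma closure_multiple_of_quotient:
  assumes p: "p \<in> carrier (group_algebra G)" and q: "q \<in> carrier (group_algebra G)"
    and dense: "densely_defined G (quotient_operator G p q)"
  shows "operator_closure G (quotient_operator G p q O left_multiplication G p)
         = left_multiplication G q"
proof
  let ?T = "quotient_operator G p q"
  have "?T O left_multiplication G p \<subseteq> left_multiplication G q"
    by (auto simp: quotient_operator_def left_multiplication_def)
  then have "operator_closure G (?T O left_multiplication G p)
             \<subseteq> operator_closure G (left_multiplication G q)"
    by (rule operator_closure_mono)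
  then show "operator_closure G (?T O left_multiplication G p) \<subseteq> left_multiplication G q"
    using quotient_operator_closed[OF _ q, of "point_mass \<one>"]
    by (simp add: left_multiplication_eq_quotient[OF q] point_mass_group_algebra)
  show "left_multiplication G q \<subseteq> operator_closure G (?T O left_multiplication G p)"
  proof (rule subrelI)
    fix \<xi> \<zeta> assume "(\<xi>, \<zeta>) \<in> left_multiplication G q"
    then have \<xi>: "\<xi> \<in> ell2 G" and \<zeta>: "\<zeta> = convolve G q \<xi>"
      by (auto simp: left_multiplication_def)
    define C where "C = (\<Sum>h\<in>{h \<in> carrier G. q h \<noteq> 0}. cmod (q h)) + 1"
    have C: "C \<ge> 1"
      by (simp add: C_def sum_nonneg)
    have "\<exists>(\<xi>', \<eta>')\<in>?T O left_multiplication G p. ell2_dist G \<xi> \<xi>' < \<epsilon> \<and> ell2_dist G \<zeta> \<eta>' < \<epsilon>"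
      if \<epsilon>: "\<epsilon> > 0" for \<epsilon>
    proof -
      have "\<epsilon> / C > 0" using \<epsilon> C by simp
      then obtain \<xi>' \<eta>' where e: "(\<xi>', \<eta>') \<in> ?T" "ell2_dist G \<xi> \<xi>' < \<epsilon> / C"
        using dense \<xi> unfolding densely_defined_def by blast
      then have mem: "\<xi>' \<in> ell2 G" "\<eta>' \<in> ell2 G" "convolve G p \<eta>' = convolve G q \<xi>'"
        by (auto simp: quotient_operator_def)
      have pair: "(\<xi>', convolve G q \<xi>') \<in> ?T O left_multiplication G p"
        using e(1) mem by (auto simp: left_multiplication_def)
      have "ell2_dist G \<zeta> (convolve G q \<xi>') = ell2_norm G (convolve G q (\<lambda>g. \<xi> g - \<xi>' g))"
        by (simp add: \<zeta> ell2_dist_def convolve_diff)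
      also have "\<dots> \<le> (C - 1) * ell2_dist G \<xi> \<xi>'"
        using ell2_norm_convolve[OF q ell2_diff[OF \<xi> mem(1)]] by (simp add: C_def ell2_dist_def)
      also have "\<dots> \<le> C * ell2_dist G \<xi> \<xi>'"
        by (intro mult_right_mono) (auto simp: ell2_dist_def ell2_norm_nonneg)
      also have "\<dots> < \<epsilon>"
        using e(2) C by (simp add: field_simps)
      finally have d: "ell2_dist G \<zeta> (convolve G q \<xi>') < \<epsilon>" .
      have "\<epsilon> / C \<le> \<epsilon>"
        using C \<epsilon> by (simp add: field_simps)
      then show ?thesis
        using pair d e(2) by (intro bexI[OF _ pair]) auto
    qed
    then show "(\<xi>, \<zeta>) \<in> operator_closure G (?T O left_multiplication G p)"
      using \<xi> \<zeta> convolve_ell2[OF q \<xi>] by (simp add: operator_closure_def)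
  qed
qed

lemma quotient_operator_factor:
  assumes "q \<in> carrier (group_algebra G)"
  shows "left_multiplication G q O quotient_operator G p (point_mass \<one>) = quotient_operator G p q"
  using convolve_ell2[OF assms]
  by (auto simp: left_multiplication_def quotient_operator_def convolve_one)

lemma quotient_operator_self:
  assumes "regular_on_ell2 G p" shows "quotient_operator G p p = Id_on (ell2 G)"
  using regular_on_ell2_cancel[OF assms] by (auto simp: quotient_operator_def)

lemma left_multiplication_one: "left_multiplication G (point_mass \<one>) = Id_on (ell2 G)"
  by (auto simp: left_multiplication_def convolve_one)

end


section \<open>Groups with a shift and commuting lamps\<close>

lemma (in group) inv_mult_cancel_left:
  assumes "a \<in> carrier G" "b \<in> carrier G"
  shows "inv a \<otimes> (a \<otimes> b) = b" and "a \<otimes> (inv a \<otimes> b) = b"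
  using assms by (simp_all flip: m_assoc)

text \<open>
  What an embedded wreath product provides inside an arbitrary group: the generator \<open>x\<close>, the
  conjugates \<open>lamp i\<close> of one nontrivial element of the copy at index \<open>0\<close>, and the finite groups
  \<open>window n\<close> of configurations supported in \<open>[-n, n]\<close>.  Abstracting from the configurations keeps
  all computations inside the ambient group.
\<close>

locale lamp_group = group G for G (structure) +
  fixes x :: 'a and lamp :: "int \<Rightarrow> 'a" and window :: "nat \<Rightarrow> 'a set"
  assumes x_closed [simp]: "x \<in> carrier G"
    and lamp_closed [simp]: "lamp i \<in> carrier G"
    and x_lamp: "x \<otimes> lamp i = lamp (i + 1) \<otimes> x"
    and lamp_commute: "lamp i \<otimes> lamp j = lamp j \<otimes> lamp i"
    and inj_lamp: "inj lamp"
    and window_subgroup: "subgroup (window n) G"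
    and window_finite: "finite (window n)"
    and window_mono: "m \<le> n \<Longrightarrow> window m \<subseteq> window n"
    and lamp_base: "lamp i \<in> (\<Union>n. window n)"
    and base_conj: "b \<in> (\<Union>n. window n) \<Longrightarrow> x \<otimes> b \<otimes> inv x \<in> (\<Union>n. window n)"
    and base_conj_inv: "b \<in> (\<Union>n. window n) \<Longrightarrow> inv x \<otimes> b \<otimes> x \<in> (\<Union>n. window n)"
    and x_pow_base: "n > 0 \<Longrightarrow> x [^] (n::nat) \<notin> (\<Union>n. window n)"
    and lamps_outside_window:
      "lamp (int n + 1) \<notin> window n" "lamp (- int n - 1) \<notin> window n"
      "lamp (int n + 1) \<otimes> lamp (- int n - 1) \<notin> window n"
begin

declare inv_mult_cancel_left [simp]

definition base :: "'a set" where
  "base = (\<Union>n. window n)"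

definition shift_diff :: "'a \<Rightarrow> complex" where
  "shift_diff = (\<lambda>g. point_mass x g - point_mass \<one> g)"

definition lamp_diff :: "'a \<Rightarrow> complex" where
  "lamp_diff = (\<lambda>g. point_mass (lamp 0) g - point_mass \<one> g)"

definition window_sum :: "nat \<Rightarrow> 'a \<Rightarrow> complex" where
  "window_sum n = (\<lambda>g. if g \<in> window n then 1 else 0)"

lemma window_sub: "window n \<subseteq> carrier G"
  by (rule subgroup.subset[OF window_subgroup])

lemma window_closed: "b \<in> window n \<Longrightarrow> b \<in> carrier G"
  using window_sub by blast

lemma base_subgroup: "subgroup base G"
proof (rule subgroupI)
  show "base \<subseteq> carrier G"
    using window_sub by (auto simp: base_def)
  show "base \<noteq> {}"
    using lamp_base[of 0] by (auto simp: base_def)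
  show "inv b \<in> base" if "b \<in> base" for b
    using that subgroup.m_inv_closed[OF window_subgroup] by (auto simp: base_def)
  show "b \<otimes> c \<in> base" if bc: "b \<in> base" "c \<in> base" for b c
  proof -
    obtain m n where "b \<in> window m" "c \<in> window n"
      using bc unfolding base_def by blast
    then have "b \<in> window (max m n)" "c \<in> window (max m n)"
      using window_mono[of m "max m n"] window_mono[of n "max m n"] by auto
    then show ?thesis
      using subgroup.m_closed[OF window_subgroup] by (auto simp: base_def)
  qed
qed

lemma base_closed: "b \<in> base \<Longrightarrow> b \<in> carrier G"
  by (rule subgroup.mem_carrier[OF base_subgroup])

lemmas base_mult = subgroup.m_closed[OF base_subgroup]
lemmas base_inv = subgroup.m_inv_closed[OF base_subgroup]

lemma lamp_in_base: "lamp i \<in> base"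
  using lamp_base by (simp add: base_def)

lemma x_conj_base_iff:
  assumes "b \<in> carrier G" shows "x \<otimes> b \<otimes> inv x \<in> base \<longleftrightarrow> b \<in> base"
proof
  assume "x \<otimes> b \<otimes> inv x \<in> base"
  then have "inv x \<otimes> (x \<otimes> b \<otimes> inv x) \<otimes> x \<in> base"
    using base_conj_inv by (simp add: base_def)
  then show "b \<in> base"
    using assms by (simp add: m_assoc)
next
  show "b \<in> base \<Longrightarrow> x \<otimes> b \<otimes> inv x \<in> base"
    using base_conj by (simp add: base_def)
qed

lemma x_pow_conj_base:
  assumes "b \<in> base" shows "x [^] (n::nat) \<otimes> b \<otimes> inv (x [^] n) \<in> base"
proof (induction n)
  case 0
  then show ?case using assms base_closed by simp
next
  case (Suc n)
  have b: "b \<in> carrier G" by (rule base_closed[OF assms])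
  have "x [^] Suc n = x \<otimes> x [^] n"
    by (rule nat_pow_Suc2) simp
  then have "x [^] Suc n \<otimes> b \<otimes> inv (x [^] Suc n) = x \<otimes> (x [^] n \<otimes> b \<otimes> inv (x [^] n)) \<otimes> inv x"
    using b by (simp add: inv_mult_group m_assoc)
  then show ?case
    using Suc x_conj_base_iff b by simp
qed

lemma x_pow_quotient_base:
  assumes "x [^] (m::nat) \<otimes> inv (x [^] (k::nat)) \<in> base" shows "m = k"
proof -
  have key: "\<not> m > k" if "x [^] m \<otimes> inv (x [^] k) \<in> base" for m k :: nat
  proof
    assume "m > k"
    then have "x [^] m = x [^] (m - k) \<otimes> x [^] k"
      by (simp add: nat_pow_mult)
    then have "x [^] (m - k) \<in> base"
      using that by (simp add: m_assoc)
    then show False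
      using x_pow_base[of "m - k"] \<open>m > k\<close> by (simp add: base_def)
  qed
  have "x [^] k \<otimes> inv (x [^] m) \<in> base"
    using base_inv[OF assms] by (simp add: inv_mult_group)
  then show ?thesis
    using key[OF assms] key[of k m] by simp
qed

lemma x_pow_lamp: "x [^] (n::nat) \<otimes> lamp i = lamp (i + int n) \<otimes> x [^] n"
proof (induction n)
  case (Suc n)
  have "x [^] Suc n = x \<otimes> x [^] n"
    by (rule nat_pow_Suc2) simp
  then have "x [^] Suc n \<otimes> lamp i = x \<otimes> (lamp (i + int n) \<otimes> x [^] n)"
    using Suc by (simp add: m_assoc)
  also have "\<dots> = (x \<otimes> lamp (i + int n)) \<otimes> x [^] n"
    by (simp add: m_assoc)
  also have "\<dots> = lamp (i + int (Suc n)) \<otimes> (x \<otimes> x [^] n)"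
    by (simp add: x_lamp m_assoc algebra_simps)
  finally show ?case
    using \<open>x [^] Suc n = x \<otimes> x [^] n\<close> by simp
qed simp

lemma x_pow_inj: "inj_on (\<lambda>n. x [^] (n::nat)) A"
proof (rule inj_onI)
  fix m k :: nat
  assume "x [^] m = x [^] k"
  then have "x [^] m \<otimes> inv (x [^] k) = \<one>"
    by simp
  then show "m = k"
    using x_pow_quotient_base subgroup.one_closed[OF base_subgroup] by simp
qed

lemma shift_diff_group_algebra: "shift_diff \<in> carrier (group_algebra G)"
  and lamp_diff_group_algebra: "lamp_diff \<in> carrier (group_algebra G)"
  unfolding shift_diff_def lamp_diff_def
  by (intro group_algebra_diff point_mass_group_algebra; simp)+

lemma window_sum_group_algebra: "window_sum n \<in> carrier (group_algebra G)"
  using window_finite window_sub by (auto simp: window_sum_def group_algebra_def)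

lemma convolve_shift_diff:
  "convolve G shift_diff \<xi> g = (if g \<in> carrier G then \<xi> (inv x \<otimes> g) - \<xi> g else 0)"
  by (simp add: shift_diff_def convolve_diff_left point_mass_group_algebra convolve_point_mass)

lemma convolve_lamp_diff:
  "convolve G lamp_diff \<xi> g = (if g \<in> carrier G then \<xi> (inv (lamp 0) \<otimes> g) - \<xi> g else 0)"
  by (simp add: lamp_diff_def convolve_diff_left point_mass_group_algebra convolve_point_mass)

lemma convolve_window_sum:
  assumes "g \<in> carrier G"
  shows "convolve G (window_sum n) \<xi> g = (\<Sum>b\<in>window n. \<xi> (inv b \<otimes> g))"
  using assms window_finite window_sub
  by (subst convolve_on[where F = "window n"]) (auto simp: window_sum_def)


section \<open>Coset sums\<close>

text \<open>The sum of \<open>f\<close> over the coset \<open>K g\<close>, which makes sense for infinite \<open>K\<close> when \<open>f\<close> has finite support.\<close>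

definition coset_sum :: "'a set \<Rightarrow> ('a \<Rightarrow> complex) \<Rightarrow> 'a \<Rightarrow> complex" where
  "coset_sum K f g = (\<Sum>s\<in>{s \<in> carrier G. f s \<noteq> 0 \<and> s \<otimes> inv g \<in> K}. f s)"

lemma coset_sum_on:
  assumes "finite F" "F \<subseteq> carrier G" "{s \<in> carrier G. f s \<noteq> 0} \<subseteq> F"
  shows "coset_sum K f g = (\<Sum>s\<in>{s \<in> F. s \<otimes> inv g \<in> K}. f s)"
  unfolding coset_sum_def by (rule sum.mono_neutral_left) (use assms in auto)

lemma coset_sum_translate:
  assumes k: "k \<in> carrier G" and g: "g \<in> carrier G"
    and iff: "\<And>t. t \<in> carrier G \<Longrightarrow> k \<otimes> t \<otimes> inv g \<in> K \<longleftrightarrow> t \<otimes> inv g' \<in> K"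
  shows "coset_sum K (\<lambda>h. if h \<in> carrier G then f (inv k \<otimes> h) else 0) g = coset_sum K f g'"
  unfolding coset_sum_def
proof (rule sum.reindex_bij_witness[where i = "\<lambda>t. k \<otimes> t" and j = "\<lambda>s. inv k \<otimes> s"])
  fix s
  assume "s \<in> {s \<in> carrier G. (if s \<in> carrier G then f (inv k \<otimes> s) else 0) \<noteq> 0 \<and> s \<otimes> inv g \<in> K}"
  then show "inv k \<otimes> s \<in> {t \<in> carrier G. f t \<noteq> 0 \<and> t \<otimes> inv g' \<in> K}"
    using k iff[of "inv k \<otimes> s"] by auto
qed (use k iff in auto)

lemma convolve_window_sum_eq_coset_sum:
  assumes "g \<in> carrier G"
  shows "convolve G (window_sum n) f g = coset_sum (window n) f g"
proof -
  have inv_mem: "inv b \<in> window n" if "b \<in> window n" for b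
    using subgroup.m_inv_closed[OF window_subgroup that] .
  have "(\<Sum>b\<in>window n. f (inv b \<otimes> g)) = (\<Sum>s\<in>{s \<in> carrier G. s \<otimes> inv g \<in> window n}. f s)"
  proof (rule sum.reindex_bij_witness[where i = "\<lambda>s. g \<otimes> inv s" and j = "\<lambda>b. inv b \<otimes> g"])
    fix b assume "b \<in> window n"
    then show "inv b \<otimes> g \<in> {s \<in> carrier G. s \<otimes> inv g \<in> window n}"
      and "g \<otimes> inv (inv b \<otimes> g) = b"
      using assms window_closed inv_mem by (simp_all add: m_assoc inv_mult_group)
  next
    fix s assume s: "s \<in> {s \<in> carrier G. s \<otimes> inv g \<in> window n}"
    then have "inv (s \<otimes> inv g) \<in> window n"
      using inv_mem by blast
    then show "g \<otimes> inv s \<in> window n" and "inv (g \<otimes> inv s) \<otimes> g = s"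
      using s assms by (simp_all add: m_assoc inv_mult_group)
  qed simp
  also have "\<dots> = coset_sum (window n) f g"
    unfolding coset_sum_def
  proof (rule sum.mono_neutral_right)
    have "{s \<in> carrier G. s \<otimes> inv g \<in> window n} \<subseteq> (\<lambda>b. b \<otimes> g) ` window n"
    proof
      fix s assume "s \<in> {s \<in> carrier G. s \<otimes> inv g \<in> window n}"
      then show "s \<in> (\<lambda>b. b \<otimes> g) ` window n"
        using assms by (intro image_eqI[of _ _ "s \<otimes> inv g"]) (auto simp: m_assoc)
    qed
    then show "finite {s \<in> carrier G. s \<otimes> inv g \<in> window n}"
      using window_finite finite_surj by blast
  qed auto
  finally show ?thesis
    by (simp add: convolve_window_sum[OF assms])
qed

text \<open>
  Translation by \<open>lamp 0\<close> preserves every coset of the base, so the sums of a multiple of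
  \<open>lamp 0 - 1\<close> vanish; translation by \<open>x\<close> permutes the cosets without finite orbits.  Hence the sums
  of \<open>\<alpha>\<close> are constant along infinite orbits of cosets, of which the support of \<open>\<alpha>\<close> meets only
  finitely many.
\<close>

lemma coset_sum_vanishes:
  assumes \<alpha>: "\<alpha> \<in> carrier (group_algebra G)" and \<beta>: "\<beta> \<in> carrier (group_algebra G)"
    and eq: "convolve G shift_diff \<alpha> = convolve G lamp_diff \<beta>" and g: "g \<in> carrier G"
  shows "coset_sum base \<alpha> g = 0"
proof -
  let ?tr = "\<lambda>k f h. if h \<in> carrier G then f (inv k \<otimes> h) else (0::complex)"
  have fin_tr: "finite {s \<in> carrier G. ?tr k f s \<noteq> 0}"
    if "f \<in> carrier (group_algebra G)" "k \<in> carrier G" for f k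
  proof -
    have "{s \<in> carrier G. ?tr k f s \<noteq> 0} \<subseteq> (\<lambda>t. k \<otimes> t) ` {t \<in> carrier G. f t \<noteq> 0}"
    proof
      fix s assume "s \<in> {s \<in> carrier G. ?tr k f s \<noteq> 0}"
      then show "s \<in> (\<lambda>t. k \<otimes> t) ` {t \<in> carrier G. f t \<noteq> 0}"
        using that(2) by (intro image_eqI[of _ _ "inv k \<otimes> s"]) (auto simp: m_assoc[symmetric])
    qed
    then show ?thesis
      using group_algebra_finite_support[OF that(1)] finite_surj by blast
  qed
  have diff: "coset_sum base (\<lambda>h. ?tr k f h - f h) g
              = coset_sum base (?tr k f) g - coset_sum base f g"
    if f: "f \<in> carrier (group_algebra G)" and k: "k \<in> carrier G" for f k g
  proof -
    let ?F = "{s \<in> carrier G. ?tr k f s \<noteq> 0} \<union> {s \<in> carrier G. f s \<noteq> 0}"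
    have F: "finite ?F" "?F \<subseteq> carrier G"
      using fin_tr[OF f k] group_algebra_finite_support[OF f] by auto
    have on: "coset_sum base f' g = (\<Sum>s\<in>{s \<in> ?F. s \<otimes> inv g \<in> base}. f' s)"
      if "\<And>s. s \<in> carrier G \<Longrightarrow> f' s \<noteq> 0 \<Longrightarrow> s \<in> ?F" for f'
      by (rule coset_sum_on[OF F]) (use that in blast)
    have "coset_sum base (\<lambda>h. ?tr k f h - f h) g
          = (\<Sum>s\<in>{s \<in> ?F. s \<otimes> inv g \<in> base}. ?tr k f s - f s)"
      by (rule on) auto
    also have "\<dots> = (\<Sum>s\<in>{s \<in> ?F. s \<otimes> inv g \<in> base}. ?tr k f s)
                 - (\<Sum>s\<in>{s \<in> ?F. s \<otimes> inv g \<in> base}. f s)"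
      by (rule sum_subtractf)
    also have "(\<Sum>s\<in>{s \<in> ?F. s \<otimes> inv g \<in> base}. ?tr k f s) = coset_sum base (?tr k f) g"
      by (rule on[symmetric]) auto
    also have "(\<Sum>s\<in>{s \<in> ?F. s \<otimes> inv g \<in> base}. f s) = coset_sum base f g"
      by (rule on[symmetric]) auto
    finally show ?thesis .
  qed
  have vanish: "f h = 0" if "f \<in> carrier (group_algebra G)" "h \<notin> carrier G" for f h
    using that by (simp add: group_algebra_def)
  have "coset_sum base (convolve G lamp_diff \<beta>) h = 0" if h: "h \<in> carrier G" for h
  proof -
    have "coset_sum base (?tr (lamp 0) \<beta>) h = coset_sum base \<beta> h"
    proof (rule coset_sum_translate[OF _ h])
      fix t assume t: "t \<in> carrier G"
      have "lamp 0 \<otimes> t \<otimes> inv h \<in> base \<longleftrightarrow> lamp 0 \<otimes> (t \<otimes> inv h) \<in> base"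
        using t h by (simp add: m_assoc)
      also have "\<dots> \<longleftrightarrow> t \<otimes> inv h \<in> base"
      proof
        assume "lamp 0 \<otimes> (t \<otimes> inv h) \<in> base"
        from base_mult[OF base_inv[OF lamp_in_base[of 0]] this] show "t \<otimes> inv h \<in> base"
          using t h by (simp add: m_assoc[symmetric])
      qed (rule base_mult[OF lamp_in_base])
      finally show "lamp 0 \<otimes> t \<otimes> inv h \<in> base \<longleftrightarrow> t \<otimes> inv h \<in> base" .
    qed simp
    moreover have "convolve G lamp_diff \<beta> = (\<lambda>h. ?tr (lamp 0) \<beta> h - \<beta> h)"
      using vanish[OF \<beta>] by (auto simp: convolve_lamp_diff)
    ultimately show ?thesis
      using diff[OF \<beta> lamp_closed] by simp
  qed
  moreover have "coset_sum base (convolve G shift_diff \<alpha>) h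
                 = coset_sum base \<alpha> (inv x \<otimes> h) - coset_sum base \<alpha> h" if h: "h \<in> carrier G" for h
  proof -
    have "coset_sum base (?tr x \<alpha>) h = coset_sum base \<alpha> (inv x \<otimes> h)"
    proof (rule coset_sum_translate[OF _ h])
      fix t assume t: "t \<in> carrier G"
      have "x \<otimes> (t \<otimes> inv (inv x \<otimes> h)) \<otimes> inv x = x \<otimes> t \<otimes> inv h"
        using t h by (simp add: inv_mult_group m_assoc)
      then show "x \<otimes> t \<otimes> inv h \<in> base \<longleftrightarrow> t \<otimes> inv (inv x \<otimes> h) \<in> base"
        using x_conj_base_iff[of "t \<otimes> inv (inv x \<otimes> h)"] t h by simp
    qed simp
    moreover have "convolve G shift_diff \<alpha> = (\<lambda>h. ?tr x \<alpha> h - \<alpha> h)"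
      using vanish[OF \<alpha>] by (auto simp: convolve_shift_diff)
    ultimately show ?thesis
      using diff[OF \<alpha> x_closed] by simp
  qed
  ultimately have step: "coset_sum base \<alpha> (inv x \<otimes> h) = coset_sum base \<alpha> h" if "h \<in> carrier G" for h
    using that eq by simp
  have inv_pow: "coset_sum base \<alpha> (inv (x [^] n) \<otimes> g) = coset_sum base \<alpha> g" for n :: nat
  proof (induction n)
    case (Suc n)
    have "inv (x [^] Suc n) \<otimes> g = inv x \<otimes> (inv (x [^] n) \<otimes> g)"
      using g by (simp add: inv_mult_group m_assoc)
    then show ?case
      using step[of "inv (x [^] n) \<otimes> g"] Suc g by simp
  qed (use g in simp)
  show ?thesis
  proof (rule ccontr)
    assume nz: "coset_sum base \<alpha> g \<noteq> 0"
    let ?S = "{s \<in> carrier G. \<alpha> s \<noteq> 0}"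
    have "\<exists>s. s \<in> ?S \<and> s \<otimes> inv (inv (x [^] n) \<otimes> g) \<in> base" for n :: nat
    proof (rule ccontr)
      assume "\<nexists>s. s \<in> ?S \<and> s \<otimes> inv (inv (x [^] n) \<otimes> g) \<in> base"
      then have "coset_sum base \<alpha> (inv (x [^] n) \<otimes> g) = 0"
        unfolding coset_sum_def by (intro sum.neutral) auto
      then show False
        using inv_pow nz by simp
    qed
    then obtain s :: "nat \<Rightarrow> 'a" where s: "\<And>n. s n \<in> ?S"
        "\<And>n. s n \<otimes> inv (inv (x [^] n) \<otimes> g) \<in> base"
      by metis
    (* The support is finite, so two of the points \<open>s n\<close> coincide; they lie in the cosets of
       \<open>x\<^sup>-\<^sup>m g\<close> and \<open>x\<^sup>-\<^sup>k g\<close>. *)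
    have "\<not> inj s"
      using finite_subset[of "range s" ?S] s(1) group_algebra_finite_support[OF \<alpha>]
        finite_imageD[of s UNIV] by auto
    then obtain m k where mk: "m \<noteq> k" "s m = s k"
      by (auto simp: inj_def)
    have c: "s k \<in> carrier G"
      using s(1) by blast
    have "inv (s m \<otimes> inv (inv (x [^] m) \<otimes> g)) \<otimes> (s k \<otimes> inv (inv (x [^] k) \<otimes> g)) \<in> base"
      by (rule base_mult[OF base_inv[OF s(2)] s(2)])
    also have "inv (s m \<otimes> inv (inv (x [^] m) \<otimes> g)) \<otimes> (s k \<otimes> inv (inv (x [^] k) \<otimes> g))
               = inv (x [^] m) \<otimes> x [^] k"
    proof -
      have "inv (s k) \<otimes> (s k \<otimes> z) = z" if "z \<in> carrier G" for z
        using c that by (simp add: m_assoc[symmetric])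
      moreover have "g \<otimes> (inv g \<otimes> z) = z" if "z \<in> carrier G" for z
        using g that by (simp add: m_assoc[symmetric])
      ultimately show ?thesis
        using c g by (simp add: mk inv_mult_group m_assoc)
    qed
    finally have "inv (x [^] m) \<otimes> x [^] k \<in> base" .
    from x_pow_conj_base[OF this, of m] have "x [^] k \<otimes> inv (x [^] m) \<in> base"
      by (simp add: m_assoc[symmetric])
    then show False
      using x_pow_quotient_base mk(1) by blast
  qed
qed

text \<open>
  A window that contains all quotients in the base of two points of the support of \<open>\<alpha>\<close> cuts this
  support in the same way as the base does, and its coset sums vanish with those of the base.
\<close>

lemma window_sum_annihilates:
  assumes \<alpha>: "\<alpha> \<in> carrier (group_algebra G)" and \<beta>: "\<beta> \<in> carrier (group_algebra G)"
    and eq: "convolve G shift_diff \<alpha> = convolve G lamp_diff \<beta>"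
  shows "\<exists>m. \<forall>n\<ge>m. convolve G (window_sum n) \<alpha> = (\<lambda>_. 0)"
proof -
  let ?S = "{s \<in> carrier G. \<alpha> s \<noteq> 0}"
  define Q where "Q = (\<lambda>(s, t). s \<otimes> inv t) ` (?S \<times> ?S) \<inter> base"
  have finQ: "finite Q"
    unfolding Q_def using group_algebra_finite_support[OF \<alpha>] by simp
  define \<nu> where "\<nu> b = (SOME n. b \<in> window n)" for b
  have \<nu>: "b \<in> window (\<nu> b)" if "b \<in> Q" for b
    unfolding \<nu>_def by (rule someI_ex) (use that in \<open>simp add: Q_def base_def\<close>)
  define m where "m = Max (insert 0 (\<nu> ` Q))"
  have m: "b \<in> window n" if "b \<in> Q" "m \<le> n" for b n
  proof -
    have "\<nu> b \<le> m"
      unfolding m_def using finQ that(1) by (intro Max_ge) auto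
    then show ?thesis
      using \<nu>[OF that(1)] window_mono[of "\<nu> b" n] that(2) by auto
  qed
  have "convolve G (window_sum n) \<alpha> g = 0" if "n \<ge> m" for n g
  proof (cases "g \<in> carrier G")
    case g: True
    show ?thesis
    proof (cases "\<exists>t\<in>?S. t \<otimes> inv g \<in> window n")
      case True
      then obtain t where t: "t \<in> ?S" "t \<otimes> inv g \<in> window n" by blast
      have "s \<otimes> inv g \<in> window n \<longleftrightarrow> s \<otimes> inv t \<in> base" if s: "s \<in> ?S" for s
      proof
        assume "s \<otimes> inv g \<in> window n"
        from subgroup.m_closed[OF window_subgroup this subgroup.m_inv_closed[OF window_subgroup t(2)]]
        have "s \<otimes> inv t \<in> window n"
          using s t g by (simp add: inv_mult_group m_assoc inv_solve_left')
        then show "s \<otimes> inv t \<in> base" by (auto simp: base_def)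
      next
        assume "s \<otimes> inv t \<in> base"
        then have "s \<otimes> inv t \<in> Q"
          using s t(1) by (force simp: Q_def)
        then have "s \<otimes> inv t \<in> window n"
          by (rule m[OF _ \<open>n \<ge> m\<close>])
        from subgroup.m_closed[OF window_subgroup this t(2)]
        show "s \<otimes> inv g \<in> window n"
          using s t g by (simp add: m_assoc inv_solve_left')
      qed
      then have "coset_sum (window n) \<alpha> g = coset_sum base \<alpha> t"
        unfolding coset_sum_def by (intro sum.cong) auto
      then show ?thesis
        using coset_sum_vanishes[OF \<alpha> \<beta> eq] t g by (simp add: convolve_window_sum_eq_coset_sum)
    next
      case False
      then have "coset_sum (window n) \<alpha> g = 0"
        unfolding coset_sum_def by (intro sum.neutral) auto
      then show ?thesis
        using g by (simp add: convolve_window_sum_eq_coset_sum)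
    qed
  qed (simp add: convolve_def)
  then show ?thesis by (auto simp: fun_eq_iff)
qed

end


context lamp_group
begin

section \<open>Dividing by the difference of the shift and the identity\<close>

text \<open>A square summable function cannot be constant along the infinite orbits of the shift.\<close>

lemma regular_shift_diff: "regular_on_ell2 G shift_diff"
  unfolding regular_on_ell2_def
proof (intro conjI ballI impI shift_diff_group_algebra)
  fix \<xi> assume \<xi>: "\<xi> \<in> ell2 G" and zero: "convolve G shift_diff \<xi> = (\<lambda>_. 0)"
  have step: "\<xi> (inv x \<otimes> g) = \<xi> g" if "g \<in> carrier G" for g
    using fun_cong[OF zero, of g] that by (simp add: convolve_shift_diff)
  have const: "\<xi> (inv (x [^] (n::nat)) \<otimes> g) = \<xi> g" if g: "g \<in> carrier G" for g n
  proof (induction n)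
    case (Suc n)
    have "inv (x [^] Suc n) \<otimes> g = inv x \<otimes> (inv (x [^] n) \<otimes> g)"
      using g by (simp add: inv_mult_group m_assoc)
    then show ?case
      using step[of "inv (x [^] n) \<otimes> g"] Suc g by simp
  qed (use g in simp)
  have "\<xi> g = 0" for g
  proof (cases "g \<in> carrier G")
    case g: True
    have bound: "sqrt (real N) * cmod (\<xi> g) \<le> ell2_norm G \<xi>" for N
    proof -
      have inj: "inj_on (\<lambda>n. inv (x [^] (n::nat)) \<otimes> g) {..<N}"
        using g inj_onD[OF x_pow_inj[of UNIV]] by (auto intro!: inj_onI dest!: inv_inj[THEN inj_onD])
      have "L2_set (\<lambda>h. cmod (\<xi> h)) ((\<lambda>n. inv (x [^] (n::nat)) \<otimes> g) ` {..<N}) \<le> ell2_norm G \<xi>"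
        by (rule L2_set_le_ell2_norm[OF \<xi>]) (use g in auto)
      moreover have "L2_set (\<lambda>h. cmod (\<xi> h)) ((\<lambda>n. inv (x [^] (n::nat)) \<otimes> g) ` {..<N})
                     = sqrt (\<Sum>n<N. (cmod (\<xi> g))\<^sup>2)"
        unfolding L2_set_def by (simp add: sum.reindex[OF inj] const[OF g])
      ultimately show ?thesis
        by (simp add: real_sqrt_mult)
    qed
    show ?thesis
    proof (rule ccontr)
      assume "\<xi> g \<noteq> 0"
      then have c: "cmod (\<xi> g) > 0" by simp
      obtain N :: nat where N: "real N > (ell2_norm G \<xi> / cmod (\<xi> g))\<^sup>2"
        using reals_Archimedean2 by blast
      have "ell2_norm G \<xi> / cmod (\<xi> g) < sqrt (real N)"
        using N by (rule real_less_rsqrt)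
      then show False
        using bound[of N] c by (simp add: field_simps)
    qed
  qed (use \<xi> in \<open>simp add: ell2_memD\<close>)
  then show "\<xi> = (\<lambda>_. 0)" by (simp add: fun_eq_iff)
qed

text \<open>The element \<open>(1 + x + \<dots> + x\<^sup>n\<^sup>-\<^sup>1) h\<close> of the group algebra.\<close>

definition shift_sum :: "nat \<Rightarrow> 'a \<Rightarrow> 'a \<Rightarrow> complex" where
  "shift_sum n h = (\<lambda>g. \<Sum>k<n. point_mass (x [^] k \<otimes> h) g)"

lemma shift_sum_ell2: "h \<in> carrier G \<Longrightarrow> shift_sum n h \<in> ell2 G"
  unfolding shift_sum_def by (rule ell2_sum) (auto intro: point_mass_ell2)

lemma convolve_point_mass_point_mass:
  assumes "k \<in> carrier G" "h \<in> carrier G"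
  shows "convolve G (point_mass k) (point_mass h) = point_mass (k \<otimes> h)"
  unfolding convolve_point_mass[OF assms(1)]
  using assms by (auto simp: point_mass_def fun_eq_iff inv_solve_left')

lemma convolve_shift_diff_point_mass:
  "h \<in> carrier G \<Longrightarrow>
   convolve G shift_diff (point_mass h) = (\<lambda>g. point_mass (x \<otimes> h) g - point_mass h g)"
  by (simp add: shift_diff_def convolve_diff_left point_mass_group_algebra convolve_point_mass_point_mass)

lemma convolve_lamp_diff_point_mass:
  "h \<in> carrier G \<Longrightarrow>
   convolve G lamp_diff (point_mass h) = (\<lambda>g. point_mass (lamp 0 \<otimes> h) g - point_mass h g)"
  by (simp add: lamp_diff_def convolve_diff_left point_mass_group_algebra convolve_point_mass_point_mass)

lemma convolve_shift_diff_shift_sum: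
  assumes h: "h \<in> carrier G"
  shows "convolve G shift_diff (shift_sum n h) = (\<lambda>g. point_mass (x [^] n \<otimes> h) g - point_mass h g)"
proof -
  have "x \<otimes> (x [^] k \<otimes> h) = x [^] Suc k \<otimes> h" for k :: nat
    using h nat_pow_Suc2[OF x_closed, of k] by (simp add: m_assoc del: nat_pow_Suc)
  then have "convolve G shift_diff (shift_sum n h) g
        = (\<Sum>k<n. point_mass (x [^] Suc k \<otimes> h) g - point_mass (x [^] k \<otimes> h) g)" for g
    using h by (simp add: shift_sum_def convolve_sum convolve_shift_diff_point_mass del: nat_pow_Suc)
  moreover have "(\<Sum>k<n. point_mass (x [^] Suc k \<otimes> h) g - point_mass (x [^] k \<otimes> h) g)
        = point_mass (x [^] n \<otimes> h) g - point_mass (x [^] (0::nat) \<otimes> h) g" for g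
    by (rule sum_lessThan_telescope)
  ultimately show ?thesis
    using h by (simp add: fun_eq_iff)
qed

text \<open>
  As \<open>x\<^sup>n\<close> carries the lamps at \<open>0\<close> and \<open>-n\<close> to those at \<open>n\<close> and \<open>0\<close>, and lamps commute, the element
  \<open>(x\<^sup>n - 1) (lamp 0 - 1) (lamp (-n) - 1)\<close> is divisible on the left both by \<open>x - 1\<close> and by
  \<open>lamp 0 - 1\<close>.  The respective quotients are \<open>swap_quotient n\<close> and \<open>swap_cofactor n\<close>.
\<close>

definition swap_quotient :: "nat \<Rightarrow> 'a \<Rightarrow> complex" where
  "swap_quotient n = (\<lambda>g. shift_sum n (lamp 0 \<otimes> lamp (- int n)) g - shift_sum n (lamp 0) g
                        - shift_sum n (lamp (- int n)) g + shift_sum n \<one> g)"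

definition swap_cofactor :: "nat \<Rightarrow> 'a \<Rightarrow> complex" where
  "swap_cofactor n = (\<lambda>g. point_mass (lamp (int n) \<otimes> x [^] n) g - point_mass (x [^] n) g
                        - point_mass (lamp (- int n)) g + point_mass \<one> g)"

lemma swap_relation: "(swap_cofactor n, swap_quotient n) \<in> quotient_operator G shift_diff lamp_diff"
proof -
  have mem: "swap_cofactor n \<in> ell2 G" "swap_quotient n \<in> ell2 G"
    unfolding swap_cofactor_def swap_quotient_def
    by (intro ell2_add ell2_diff point_mass_ell2 shift_sum_ell2; simp)+
  have e1: "x [^] n \<otimes> lamp (- int n) = lamp 0 \<otimes> x [^] n"
    and e2: "x [^] n \<otimes> lamp 0 = lamp (int n) \<otimes> x [^] n"
    by (simp_all add: x_pow_lamp)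
  have "x [^] n \<otimes> (lamp 0 \<otimes> lamp (- int n)) = (x [^] n \<otimes> lamp 0) \<otimes> lamp (- int n)"
    by (simp add: m_assoc)
  also have "\<dots> = lamp (int n) \<otimes> (x [^] n \<otimes> lamp (- int n))"
    by (simp only: e2) (simp add: m_assoc)
  also have "\<dots> = (lamp (int n) \<otimes> lamp 0) \<otimes> x [^] n"
    by (simp only: e1) (simp add: m_assoc)
  also have "\<dots> = lamp 0 \<otimes> (lamp (int n) \<otimes> x [^] n)"
    by (simp only: lamp_commute[of "int n" 0]) (simp add: m_assoc)
  finally have e3: "x [^] n \<otimes> (lamp 0 \<otimes> lamp (- int n)) = lamp 0 \<otimes> (lamp (int n) \<otimes> x [^] n)" .
  have "convolve G shift_diff (swap_quotient n) = convolve G lamp_diff (swap_cofactor n)"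
    unfolding swap_quotient_def swap_cofactor_def
    by (simp add: convolve_add convolve_diff convolve_shift_diff_shift_sum
        convolve_lamp_diff_point_mass e1 e2 e3 algebra_simps)
  then show ?thesis
    using mem by (simp add: quotient_operator_def)
qed

lemma point_mass_average_small:
  fixes \<gamma> :: "nat \<Rightarrow> 'a"
  assumes "inj \<gamma>" "\<And>i. \<gamma> i \<in> carrier G"
  shows "ell2_norm G (\<lambda>h. \<Sum>i<N. point_mass (\<gamma> i) h / of_nat N) \<le> 1 / sqrt (real N)"
    and "(\<lambda>h. \<Sum>i<N. point_mass (\<gamma> i) h / of_nat N) \<in> ell2 G"
proof -
  show "ell2_norm G (\<lambda>h. \<Sum>i<N. point_mass (\<gamma> i) h / of_nat N) \<le> 1 / sqrt (real N)"
  proof (cases "N = 0")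
    case False
    then show ?thesis
      using assms inj_on_subset[OF assms(1), of "{..<N}"] by (intro ell2_norm_average_le) auto
  qed simp
  show "(\<lambda>h. \<Sum>i<N. point_mass (\<gamma> i) h / of_nat N) \<in> ell2 G"
  proof (rule ell2_sum)
    fix i
    show "(\<lambda>h. point_mass (\<gamma> i) h / of_nat N) \<in> ell2 G"
      using ell2_scale[OF point_mass_ell2[OF assms(2)], of "1 / of_nat N" i] by simp
  qed simp
qed

lemma inverse_sqrt_small:
  assumes "(\<epsilon>::real) > 0"
  obtains N :: nat where "N > 0" "c / sqrt (real N) < \<epsilon>"
proof -
  obtain N :: nat where N: "real N > max 1 ((\<bar>c\<bar> / \<epsilon>)\<^sup>2)"
    using reals_Archimedean2 by blast
  then have "\<bar>c\<bar> / \<epsilon> < sqrt (real N)"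
    by (intro real_less_rsqrt) simp
  moreover have pos: "N > 0" using N by (cases N) auto
  ultimately have "c / sqrt (real N) < \<epsilon>"
    using assms by (simp add: field_simps)
  then show thesis using that pos by blast
qed

text \<open>
  The element \<open>1 - x\<^sup>n\<close> is divisible by \<open>x - 1\<close>, and the average of the elements \<open>x\<^sup>n\<close> is small.
\<close>

lemma dense_shift_inverse: "densely_defined G (quotient_operator G shift_diff (point_mass \<one>))"
proof (rule quotient_operator_dense[OF regular_shift_diff])
  fix \<epsilon> :: real assume "\<epsilon> > 0"
  then obtain N :: nat where N: "N > 0" "1 / sqrt (real N) < \<epsilon>"
    by (rule inverse_sqrt_small)
  let ?T = "quotient_operator G shift_diff (point_mass \<one>)"
  have lin: "linear_operator G ?T"
    by (rule quotient_operator_linear[OF regular_shift_diff])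
  define r where "r = (\<lambda>g. \<Sum>i<N. (1 / of_nat N) * (point_mass (x [^] Suc i) g - point_mass \<one> g))"
  have mem: "(\<lambda>g. point_mass (x [^] (n::nat)) g - point_mass \<one> g) \<in> Domain ?T" for n
  proof
    have "(\<lambda>g. point_mass (x [^] n) g - point_mass \<one> g) \<in> ell2 G"
      by (intro ell2_diff point_mass_ell2) auto
    then show "(\<lambda>g. point_mass (x [^] n) g - point_mass \<one> g, shift_sum n \<one>) \<in> ?T"
      by (simp add: quotient_operator_def shift_sum_ell2 convolve_shift_diff_shift_sum convolve_one)
  qed
  have "r \<in> Domain ?T"
    unfolding r_def by (rule Domain_sum[OF lin]) (simp, rule Domain_scale[OF lin mem])
  then have "(\<lambda>g. (-1) * r g) \<in> Domain ?T"
    by (rule Domain_scale[OF lin])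
  moreover have "ell2_dist G (point_mass \<one>) (\<lambda>g. (-1) * r g) < \<epsilon>"
  proof -
    have "point_mass \<one> g - (-1) * r g = (\<Sum>i<N. point_mass (x [^] Suc i) g / of_nat N)" for g
      using N(1) by (simp add: r_def sum_subtractf right_diff_distrib del: nat_pow_Suc)
    moreover have "inj (\<lambda>i. x [^] Suc i)"
      using inj_onD[OF x_pow_inj[of UNIV]] by (fastforce intro: injI simp del: nat_pow_Suc)
    ultimately show ?thesis
      using point_mass_average_small(1)[of "\<lambda>i. x [^] Suc i" N] N(2)
      by (simp add: ell2_dist_def del: nat_pow_Suc)
  qed
  ultimately show "\<exists>r\<in>Domain ?T. ell2_dist G (point_mass \<one>) r < \<epsilon>" by blast
qed

text \<open>
  The cofactor for \<open>n\<close> is \<open>1\<close> plus a signed sum of three group elements that vary injectively with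
  \<open>n\<close>, so the averages of the cofactors tend to \<open>1\<close>.
\<close>

lemma dense_shift_quotient: "densely_defined G (quotient_operator G shift_diff lamp_diff)"
proof (rule quotient_operator_dense[OF regular_shift_diff])
  fix \<epsilon> :: real assume "\<epsilon> > 0"
  then obtain N :: nat where N: "N > 0" "3 / sqrt (real N) < \<epsilon>"
    by (rule inverse_sqrt_small)
  let ?T = "quotient_operator G shift_diff lamp_diff"
  have lin: "linear_operator G ?T"
    by (rule quotient_operator_linear[OF regular_shift_diff])
  (* The indices start at \<open>1\<close>: for \<open>n = 0\<close> the cofactor is zero. *)
  define \<gamma> where "\<gamma> i = lamp (- int (Suc i))" for i
  define \<delta> where "\<delta> i = x [^] Suc i" for i :: nat
  define \<phi> where "\<phi> i = lamp (int (Suc i)) \<otimes> x [^] Suc i" for i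
  have inj\<gamma>: "inj \<gamma>"
    unfolding \<gamma>_def by (rule injI) (auto dest: inj_lamp[THEN injD])
  have inj\<delta>: "inj \<delta>"
    unfolding \<delta>_def using inj_onD[OF x_pow_inj[of UNIV]]
    by (fastforce intro: injI simp del: nat_pow_Suc)
  have inj\<phi>: "inj \<phi>"
  proof (rule injI)
    fix i j assume "\<phi> i = \<phi> j"
    then have "inv (lamp (int (Suc j))) \<otimes> (\<phi> i) \<otimes> inv (x [^] Suc i)
               = inv (lamp (int (Suc j))) \<otimes> (\<phi> j) \<otimes> inv (x [^] Suc i)"
      by simp
    then have eq: "inv (lamp (int (Suc j))) \<otimes> lamp (int (Suc i)) = x [^] Suc j \<otimes> inv (x [^] Suc i)"
      by (simp add: \<phi>_def m_assoc del: nat_pow_Suc of_nat_Suc)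
    have "inv (lamp (int (Suc j))) \<otimes> lamp (int (Suc i)) \<in> base"
      by (intro base_mult base_inv lamp_in_base)
    then show "i = j"
      using x_pow_quotient_base[of "Suc j" "Suc i"] unfolding eq by simp
  qed
  have cl: "\<gamma> i \<in> carrier G" "\<delta> i \<in> carrier G" "\<phi> i \<in> carrier G" for i
    by (simp_all add: \<gamma>_def \<delta>_def \<phi>_def)
  define av where "av \<psi> = (\<lambda>g. \<Sum>i<N. point_mass (\<psi> i) g / of_nat N)" for \<psi> :: "nat \<Rightarrow> 'a"
  note small = point_mass_average_small(1)[of _ N, folded av_def]
  note av_ell2 = point_mass_average_small(2)[of _ N, folded av_def]
  define r where "r = (\<lambda>g. \<Sum>i<N. (1 / of_nat N) * swap_cofactor (Suc i) g)"
  have "r \<in> Domain ?T"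
    unfolding r_def using swap_relation
    by (intro Domain_sum[OF lin] Domain_scale[OF lin]) auto
  moreover have "ell2_dist G (point_mass \<one>) r < \<epsilon>"
  proof -
    have "(\<Sum>i<N. (1 / of_nat N) * swap_cofactor (Suc i) g) =
          av \<phi> g - av \<delta> g - av \<gamma> g + point_mass \<one> g" for g
      using N(1) unfolding swap_cofactor_def av_def \<gamma>_def \<delta>_def \<phi>_def
      by (simp add: sum_subtractf sum.distrib right_diff_distrib distrib_left
          del: nat_pow_Suc of_nat_Suc)
    then have "point_mass \<one> g - r g = (av \<delta> g + av \<gamma> g) + (-1) * av \<phi> g" for g
      by (simp add: r_def)
    then have "ell2_dist G (point_mass \<one>) r = ell2_norm G (\<lambda>g. (av \<delta> g + av \<gamma> g) + (-1) * av \<phi> g)"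
      by (simp add: ell2_dist_def)
    also have "\<dots> \<le> ell2_norm G (\<lambda>g. av \<delta> g + av \<gamma> g) + ell2_norm G (\<lambda>g. (-1) * av \<phi> g)"
      by (rule ell2_norm_triangle[OF ell2_add ell2_scale])
        (use av_ell2 inj\<gamma> inj\<delta> inj\<phi> cl in auto)
    also have "\<dots> \<le> (ell2_norm G (av \<delta>) + ell2_norm G (av \<gamma>)) + cmod (-1) * ell2_norm G (av \<phi>)"
      by (intro add_mono ell2_norm_triangle ell2_norm_scale)
        (use av_ell2 inj\<gamma> inj\<delta> inj\<phi> cl in auto)
    also have "\<dots> \<le> 3 / sqrt (real N)"
      using small[OF inj\<gamma> cl(1)] small[OF inj\<delta> cl(2)] small[OF inj\<phi> cl(3)] by simp
    finally show ?thesis using N(2) by simp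
  qed
  ultimately show "\<exists>r\<in>Domain ?T. ell2_dist G (point_mass \<one>) r < \<epsilon>" by blast
qed


section \<open>Failure of flatness\<close>

lemma convolve_window_sum_point_mass:
  assumes "h \<in> carrier G" "g \<in> carrier G"
  shows "convolve G (window_sum n) (point_mass h) g = (if g \<otimes> inv h \<in> window n then 1 else 0)"
proof -
  have "inv b \<otimes> g = h \<longleftrightarrow> b = g \<otimes> inv h" if "b \<in> window n" for b
    using assms window_closed[OF that] by (auto simp: inv_solve_left' inv_solve_right m_assoc)
  then have "convolve G (window_sum n) (point_mass h) g
             = (\<Sum>b\<in>window n. if b = g \<otimes> inv h then 1 else 0)"
    using assms by (auto simp: convolve_window_sum point_mass_def intro!: sum.cong)
  then show ?thesis
    using window_finite by simp
qed

text \<open>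
  The coefficient at \<open>x\<^sup>m\<close> with \<open>m = n + 1\<close> is not zero.  Only the summands of the geometric sums with
  the power \<open>x\<^sup>m\<close> lie in the coset of \<open>x\<^sup>m\<close> modulo the base.  Of the four products of lamps, which
  conjugation by \<open>x\<^sup>m\<close> moves from the indices \<open>0\<close> and \<open>-2 m\<close> to \<open>m\<close> and \<open>-m\<close>, only the empty one lies in
  the window.
\<close>

lemma window_sum_swap_quotient:
  "convolve G (window_sum n) (swap_quotient (2 * (n + 1))) \<noteq> (\<lambda>_. 0)"
proof -
  define m where "m = n + 1"
  let ?k = "2 * m"
  have m_int: "int m = int n + 1" by (simp add: m_def)
  have val: "convolve G (window_sum n) (shift_sum ?k h) (x [^] m)
             = (if x [^] m \<otimes> inv h \<otimes> inv (x [^] m) \<in> window n then 1 else 0)" if h: "h \<in> base" for h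
  proof -
    have hc: "h \<in> carrier G" by (rule base_closed[OF h])
    have "x [^] m \<otimes> inv (x [^] k \<otimes> h) \<notin> window n" if "k \<noteq> m" for k :: nat
    proof
      assume "x [^] m \<otimes> inv (x [^] k \<otimes> h) \<in> window n"
      then have "x [^] m \<otimes> inv (x [^] k \<otimes> h) \<in> base"
        by (auto simp: base_def)
      from base_mult[OF this x_pow_conj_base[OF h, of k]]
      have "x [^] m \<otimes> inv (x [^] k) \<in> base"
        using hc by (simp add: inv_mult_group m_assoc)
      then show False
        using x_pow_quotient_base that by blast
    qed
    moreover have "x [^] m \<otimes> inv (x [^] m \<otimes> h) = x [^] m \<otimes> inv h \<otimes> inv (x [^] m)"
      using hc by (simp add: inv_mult_group m_assoc)
    ultimately have single: "convolve G (window_sum n) (point_mass (x [^] k \<otimes> h)) (x [^] m)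
         = (if k = m then if x [^] m \<otimes> inv h \<otimes> inv (x [^] m) \<in> window n then 1 else 0 else 0)"
      for k :: nat
      using hc by (simp add: convolve_window_sum_point_mass)
    have "m < ?k" by (simp add: m_def)
    then show ?thesis
      unfolding shift_sum_def convolve_sum single by simp
  qed
  have inv_iff: "inv b \<in> window n \<longleftrightarrow> b \<in> window n" if "b \<in> carrier G" for b
    using subgroup.m_inv_closed[OF window_subgroup, of "inv b" n]
      subgroup.m_inv_closed[OF window_subgroup, of b n] that by auto
  have conj: "x [^] m \<otimes> inv h \<otimes> inv (x [^] m) \<in> window n \<longleftrightarrow> h' \<in> window n"
    if "h \<in> carrier G" "h' \<in> carrier G" "x [^] m \<otimes> h = h' \<otimes> x [^] m" for h h'
  proof -
    have "inv (x [^] m \<otimes> inv h \<otimes> inv (x [^] m)) = h'"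
      using that by (simp add: inv_mult_group m_assoc[symmetric]) (simp add: m_assoc)
    then show ?thesis
      using inv_iff[of "x [^] m \<otimes> inv h \<otimes> inv (x [^] m)"] that by simp
  qed
  let ?a = "lamp 0" and ?b = "lamp (- int ?k)"
  have a: "x [^] m \<otimes> ?a = lamp (int n + 1) \<otimes> x [^] m"
    and b: "x [^] m \<otimes> ?b = lamp (- int n - 1) \<otimes> x [^] m"
    using x_pow_lamp[of m 0] x_pow_lamp[of m "- int ?k"] by (simp_all add: m_int)
  have "x [^] m \<otimes> (?a \<otimes> ?b) = lamp (int n + 1) \<otimes> (x [^] m \<otimes> ?b)"
    using a by (simp flip: m_assoc)
  then have ab: "x [^] m \<otimes> (?a \<otimes> ?b) = (lamp (int n + 1) \<otimes> lamp (- int n - 1)) \<otimes> x [^] m"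
    by (simp only: b) (simp add: m_assoc)
  have one: "x [^] m \<otimes> inv \<one> \<otimes> inv (x [^] m) \<in> window n"
    using subgroup.one_closed[OF window_subgroup] by simp
  have "convolve G (window_sum n) (swap_quotient ?k) (x [^] m) = 1"
    unfolding swap_quotient_def convolve_add convolve_diff
    using val[OF base_mult[OF lamp_in_base lamp_in_base]] val[OF lamp_in_base]
      val[OF subgroup.one_closed[OF base_subgroup]] one
      conj[OF _ _ a] conj[OF _ _ b] conj[OF _ _ ab] lamps_outside_window
    by simp
  then show ?thesis
    by (auto simp: m_def dest: fun_cong)
qed

text \<open>
  Both the division closure and the ring of all affiliated operators are of this form: they differ
  only in their carriers.
\<close>

lemma not_flat_subring:
  assumes D: "D \<subseteq> carrier (affiliated_ring G)"
    and u: "quotient_operator G shift_diff lamp_diff \<in> D" and one: "Id_on (ell2 G) \<in> D"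
  shows "\<not> flat_left_module (group_algebra G)
           (module_along (left_multiplication G) ((affiliated_ring G)\<lparr>carrier := D\<rparr>))"
proof
  define M where "M = module_along (left_multiplication G) ((affiliated_ring G)\<lparr>carrier := D\<rparr>)"
  assume "flat_left_module (group_algebra G)
           (module_along (left_multiplication G) ((affiliated_ring G)\<lparr>carrier := D\<rparr>))"
  then interpret M: flat_left_module "group_algebra G" M
    by (simp only: M_def)
  have carM: "carrier M = D"
    by (simp add: M_def module_along_def)
  have zeroM: "\<zero>\<^bsub>M\<^esub> = ell2 G \<times> {\<lambda>_. 0}"
    by (simp add: M_def module_along_def affiliated_ring_def)
  have act: "\<alpha> \<odot>\<^bsub>M\<^esub> T = operator_closure G (T O left_multiplication G \<alpha>)" for \<alpha> T
    by (simp add: M_def module_along_def affiliated_ring_def)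
  have mult: "\<alpha> \<otimes>\<^bsub>group_algebra G\<^esub> \<beta> = convolve G \<alpha> \<beta>" for \<alpha> \<beta>
    by (simp add: group_algebra_def)
  have zeroR: "\<zero>\<^bsub>group_algebra G\<^esub> = (\<lambda>_. 0)"
    by (simp add: group_algebra_def)
  let ?u = "quotient_operator G shift_diff lamp_diff"
  let ?N = "\<lambda>n. window_sum n"
  (* All large windows, and not just one, so that \<open>Z\<close> is closed under addition. *)
  define Z where "Z = {m \<in> carrier M. \<exists>k. \<forall>n\<ge>k. ?N n \<odot>\<^bsub>M\<^esub> m = \<zero>\<^bsub>M\<^esub>}"
  have Zsub: "subgroup Z (add_monoid M)"
  proof (rule group.subgroupI)
    show "group (add_monoid M)"
      using M.M.a_group .
    show "Z \<subseteq> carrier (add_monoid M)"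
      by (auto simp: Z_def)
    have "\<zero>\<^bsub>M\<^esub> \<in> Z"
      using M.smult_r_null[OF window_sum_group_algebra] by (simp add: Z_def)
    then show "Z \<noteq> {}" by blast
  next
    fix m assume m: "m \<in> Z"
    then obtain k where k: "\<And>n. n \<ge> k \<Longrightarrow> ?N n \<odot>\<^bsub>M\<^esub> m = \<zero>\<^bsub>M\<^esub>" and mem: "m \<in> carrier M"
      unfolding Z_def by blast
    have "?N n \<odot>\<^bsub>M\<^esub> (\<ominus>\<^bsub>M\<^esub> m) = \<zero>\<^bsub>M\<^esub>" if "n \<ge> k" for n
      using that k mem by (simp add: M.smult_r_minus[OF window_sum_group_algebra])
    then have "\<ominus>\<^bsub>M\<^esub> m \<in> Z"
      using mem unfolding Z_def by blast
    then show "inv\<^bsub>add_monoid M\<^esub> m \<in> Z"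
      by (simp add: a_inv_def)
  next
    fix m m' assume "m \<in> Z" "m' \<in> Z"
    then obtain k k' where k: "\<And>n. n \<ge> k \<Longrightarrow> ?N n \<odot>\<^bsub>M\<^esub> m = \<zero>\<^bsub>M\<^esub>"
        "\<And>n. n \<ge> k' \<Longrightarrow> ?N n \<odot>\<^bsub>M\<^esub> m' = \<zero>\<^bsub>M\<^esub>" and mem: "m \<in> carrier M" "m' \<in> carrier M"
      unfolding Z_def by blast
    have "?N n \<odot>\<^bsub>M\<^esub> (m \<oplus>\<^bsub>M\<^esub> m') = \<zero>\<^bsub>M\<^esub>" if "n \<ge> max k k'" for n
      using that k mem by (simp add: M.smult_r_distr[OF window_sum_group_algebra])
    then have "m \<oplus>\<^bsub>M\<^esub> m' \<in> Z"
      using mem unfolding Z_def by blast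
    then show "m \<otimes>\<^bsub>add_monoid M\<^esub> m' \<in> Z" by simp
  qed
  have "?u \<in> Z"
  proof (rule M.relation_coordinate_absorbed[OF shift_diff_group_algebra lamp_diff_group_algebra _ _ _ Zsub])
    show "?u \<in> carrier M" and "Id_on (ell2 G) \<in> carrier M"
      using u one by (simp_all add: carM)
    have "Id_on (ell2 G) O left_multiplication G lamp_diff = left_multiplication G lamp_diff"
      by (auto simp: left_multiplication_def)
    then have "lamp_diff \<odot>\<^bsub>M\<^esub> Id_on (ell2 G) = left_multiplication G lamp_diff"
      using quotient_operator_closed[OF _ lamp_diff_group_algebra, of "point_mass \<one>"]
      by (simp add: act left_multiplication_eq_quotient[OF lamp_diff_group_algebra]
          point_mass_group_algebra)
    then show "shift_diff \<odot>\<^bsub>M\<^esub> ?u = lamp_diff \<odot>\<^bsub>M\<^esub> Id_on (ell2 G)"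
      using closure_multiple_of_quotient[OF shift_diff_group_algebra lamp_diff_group_algebra
          dense_shift_quotient] by (simp add: act)
  next
    fix \<alpha> \<beta> m
    assume \<alpha>: "\<alpha> \<in> carrier (group_algebra G)" and \<beta>: "\<beta> \<in> carrier (group_algebra G)"
      and eq: "shift_diff \<otimes>\<^bsub>group_algebra G\<^esub> \<alpha> = lamp_diff \<otimes>\<^bsub>group_algebra G\<^esub> \<beta>"
      and m: "m \<in> carrier M"
    obtain k where k: "\<And>n. n \<ge> k \<Longrightarrow> convolve G (?N n) \<alpha> = (\<lambda>_. 0)"
      using window_sum_annihilates[OF \<alpha> \<beta>] eq by (auto simp: mult)
    have "?N n \<odot>\<^bsub>M\<^esub> (\<alpha> \<odot>\<^bsub>M\<^esub> m) = \<zero>\<^bsub>M\<^esub>" if "n \<ge> k" for n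
    proof -
      have "?N n \<odot>\<^bsub>M\<^esub> (\<alpha> \<odot>\<^bsub>M\<^esub> m) = (?N n \<otimes>\<^bsub>group_algebra G\<^esub> \<alpha>) \<odot>\<^bsub>M\<^esub> m"
        by (rule M.smult_assoc[symmetric, OF window_sum_group_algebra \<alpha> m])
      also have "\<dots> = \<zero>\<^bsub>M\<^esub>"
        using k[OF that] M.smult_l_null[OF m] by (simp add: mult zeroR)
      finally show ?thesis .
    qed
    then show "\<alpha> \<odot>\<^bsub>M\<^esub> m \<in> Z"
      using M.smult_closed[OF \<alpha> m] unfolding Z_def by blast
  qed
  then obtain n where "?N n \<odot>\<^bsub>M\<^esub> ?u = \<zero>\<^bsub>M\<^esub>"
    unfolding Z_def by blast
  then have cl: "operator_closure G (?u O left_multiplication G (?N n)) = ell2 G \<times> {\<lambda>_. 0}"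
    by (simp add: act zeroM)
  let ?k = "2 * (n + 1)"
  have "(swap_cofactor ?k, convolve G (?N n) (swap_quotient ?k)) \<in> ?u O left_multiplication G (?N n)"
    using swap_relation[of ?k] by (auto simp: left_multiplication_def quotient_operator_def)
  moreover have "?u O left_multiplication G (?N n) \<subseteq> ell2 G \<times> ell2 G"
    using convolve_ell2[OF window_sum_group_algebra]
    by (auto simp: left_multiplication_def quotient_operator_def)
  ultimately have "(swap_cofactor ?k, convolve G (?N n) (swap_quotient ?k)) \<in> ell2 G \<times> {\<lambda>_. 0}"
    using operator_closure_superset cl by blast
  then show False
    using window_sum_swap_quotient by simp
qed

lemma quotient_affiliated:
  "quotient_operator G shift_diff lamp_diff \<in> carrier (affiliated_ring G)"
  "quotient_operator G shift_diff (point_mass \<one>) \<in> carrier (affiliated_ring G)"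
  "Id_on (ell2 G) \<in> carrier (affiliated_ring G)"
proof -
  show "quotient_operator G shift_diff lamp_diff \<in> carrier (affiliated_ring G)"
    by (rule quotient_operator_affiliated[OF regular_shift_diff lamp_diff_group_algebra dense_shift_quotient])
  show "quotient_operator G shift_diff (point_mass \<one>) \<in> carrier (affiliated_ring G)"
    by (rule quotient_operator_affiliated[OF regular_shift_diff _ dense_shift_inverse])
      (simp add: point_mass_group_algebra)
  have "densely_defined G (Id_on (ell2 G))"
    unfolding densely_defined_def
  proof (intro ballI allI impI)
    fix \<xi> and \<epsilon> :: real assume "\<xi> \<in> ell2 G" "\<epsilon> > 0"
    then show "\<exists>\<xi>'\<in>Domain (Id_on (ell2 G)). ell2_dist G \<xi> \<xi>' < \<epsilon>"
      by (intro bexI[of _ \<xi>]) auto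
  qed
  then show "Id_on (ell2 G) \<in> carrier (affiliated_ring G)"
    using quotient_operator_affiliated[OF regular_on_ell2_one, of "point_mass \<one>"]
    by (simp add: quotient_operator_self[OF regular_on_ell2_one] point_mass_group_algebra)
qed

text \<open>
  The division closure contains the inverse of \<open>x - 1\<close>, and the closed operator \<open>(x - 1)\<^sup>-\<^sup>1 (lamp 0 - 1)\<close>
  is its product with \<open>lamp 0 - 1\<close>.
\<close>

lemma quotient_in_division_closure:
  "quotient_operator G shift_diff lamp_diff
   \<in> division_closure (affiliated_ring G) (left_multiplication G ` carrier (group_algebra G))"
  unfolding division_closure_def
proof (intro CollectI conjI quotient_affiliated allI impI)
  fix D
  assume "subring D (affiliated_ring G) \<and> left_multiplication G ` carrier (group_algebra G) \<subseteq> D \<and>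
          division_closed (affiliated_ring G) D"
  then have D: "subring D (affiliated_ring G)" and div: "division_closed (affiliated_ring G) D"
    and L: "\<And>\<alpha>. \<alpha> \<in> carrier (group_algebra G) \<Longrightarrow> left_multiplication G \<alpha> \<in> D"
    by auto
  let ?p = "shift_diff" and ?q = "lamp_diff"
  let ?y = "quotient_operator G ?p (point_mass \<one>)"
  have mult: "S \<otimes>\<^bsub>affiliated_ring G\<^esub> T = operator_closure G (T O S)" for S T
    by (simp add: affiliated_ring_def)
  have one: "\<one>\<^bsub>affiliated_ring G\<^esub> = Id_on (ell2 G)"
    by (simp add: affiliated_ring_def)
  have pm: "point_mass \<one> \<in> carrier (group_algebra G)"
    by (simp add: point_mass_group_algebra)
  have "left_multiplication G ?p \<otimes>\<^bsub>affiliated_ring G\<^esub> ?y = \<one>\<^bsub>affiliated_ring G\<^esub>"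
    using closure_multiple_of_quotient[OF shift_diff_group_algebra pm dense_shift_inverse]
    by (simp add: mult one left_multiplication_one)
  moreover have "?y \<otimes>\<^bsub>affiliated_ring G\<^esub> left_multiplication G ?p = \<one>\<^bsub>affiliated_ring G\<^esub>"
    using quotient_operator_closed[OF shift_diff_group_algebra shift_diff_group_algebra]
    by (simp add: mult one quotient_operator_factor[OF shift_diff_group_algebra]
        quotient_operator_self[OF regular_shift_diff])
  ultimately have "?y \<in> D"
    using div L[OF shift_diff_group_algebra] quotient_affiliated(2)
    unfolding division_closed_def by blast
  then have "?y \<otimes>\<^bsub>affiliated_ring G\<^esub> left_multiplication G ?q \<in> D"
    using subringE(6)[OF D] L[OF lamp_diff_group_algebra] by blast
  then show "quotient_operator G ?p ?q \<in> D"
    using quotient_operator_closed[OF shift_diff_group_algebra lamp_diff_group_algebra]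
    by (simp add: mult quotient_operator_factor[OF lamp_diff_group_algebra])
qed

lemma not_flat:
  "\<not> flat_left_module (group_algebra G) (division_closure_module G)"
  "\<not> flat_left_module (group_algebra G) (affiliated_module G)"
proof -
  let ?D = "division_closure (affiliated_ring G) (left_multiplication G ` carrier (group_algebra G))"
  have "Id_on (ell2 G) \<in> ?D"
    unfolding division_closure_def
  proof (intro CollectI conjI quotient_affiliated allI impI)
    fix D assume "subring D (affiliated_ring G) \<and>
      left_multiplication G ` carrier (group_algebra G) \<subseteq> D \<and> division_closed (affiliated_ring G) D"
    then show "Id_on (ell2 G) \<in> D"
      using subringE(3)[of D "affiliated_ring G"] by (simp add: affiliated_ring_def)
  qed
  moreover have "?D \<subseteq> carrier (affiliated_ring G)"
    by (auto simp: division_closure_def)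
  ultimately show "\<not> flat_left_module (group_algebra G) (division_closure_module G)"
    unfolding division_closure_module_def division_closure_ring_def
    using quotient_in_division_closure by (intro not_flat_subring)
  have "(affiliated_ring G)\<lparr>carrier := carrier (affiliated_ring G)\<rparr> = affiliated_ring G"
    by simp
  then show "\<not> flat_left_module (group_algebra G) (affiliated_module G)"
    unfolding affiliated_module_def
    using not_flat_subring[of "carrier (affiliated_ring G)"] quotient_affiliated by simp
qed

end


section \<open>The wreath product\<close>

lemma wreath_int_carrier:
  assumes "group H"
  shows "(f, m) \<in> carrier (wreath_int H) \<longleftrightarrow>
         (\<forall>i. f i \<in> carrier H) \<and> finite {i. f i \<noteq> \<one>\<^bsub>H\<^esub>}"
  using assms
  by (auto simp: wreath_int_def wreath_base_def carrier_sum_group PiE_UNIV_domain Pi_iff)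

lemma wreath_int_mult:
  "(f, m) \<otimes>\<^bsub>wreath_int H\<^esub> (g, n) = (\<lambda>i. f i \<otimes>\<^bsub>H\<^esub> g (i - m), m + n)"
  by (simp add: wreath_int_def wreath_base_def wreath_shift_def restrict_UNIV)

definition single_lamp :: "('h, 'k) monoid_scheme \<Rightarrow> 'h \<Rightarrow> int \<Rightarrow> int \<Rightarrow> 'h" where
  "single_lamp H a i = (\<lambda>j. if j = i then a else \<one>\<^bsub>H\<^esub>)"

definition window_configs :: "('h, 'k) monoid_scheme \<Rightarrow> nat \<Rightarrow> (int \<Rightarrow> 'h) set" where
  "window_configs H n = {f. (\<forall>i. f i \<in> carrier H) \<and> (\<forall>i. \<bar>i\<bar> > int n \<longrightarrow> f i = \<one>\<^bsub>H\<^esub>)}"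

lemma finite_window_configs:
  assumes "finite (carrier H)" shows "finite (window_configs H n)"
proof -
  have "window_configs H n \<subseteq>
        {f. \<forall>i. (i \<in> {- int n..int n} \<longrightarrow> f i \<in> carrier H) \<and> (i \<notin> {- int n..int n} \<longrightarrow> f i = \<one>\<^bsub>H\<^esub>)}"
    by (force simp: window_configs_def abs_le_iff)
  then show ?thesis
    using finite_set_of_finite_funs[OF _ assms, of "{- int n..int n}"] finite_subset by blast
qed

lemma finite_support_window_configs:
  "f \<in> window_configs H n \<Longrightarrow> finite {i. f i \<noteq> \<one>\<^bsub>H\<^esub>}"
  by (rule finite_subset[of _ "{- int n..int n}"]) (force simp: window_configs_def abs_le_iff)+

lemma in_some_window_configs:
  assumes "\<And>i. f i \<in> carrier H" and fin: "finite {i. f i \<noteq> \<one>\<^bsub>H\<^esub>}"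
  shows "\<exists>n. f \<in> window_configs H n"
proof -
  define n where "n = Max (insert 0 ((\<lambda>i. nat \<bar>i\<bar>) ` {i. f i \<noteq> \<one>\<^bsub>H\<^esub>}))"
  have "nat \<bar>i\<bar> \<le> n" if "f i \<noteq> \<one>\<^bsub>H\<^esub>" for i
    unfolding n_def using fin that by (intro Max_ge) auto
  then have "f \<in> window_configs H n"
    using assms(1) by (force simp: window_configs_def)
  then show ?thesis ..
qed

text \<open>
  The windows exhaust the base because its configurations have finite support, and they are finite
  because \<open>H\<close> is.
\<close>

lemma lamp_group_of_wreath_embedding:
  fixes H :: "('h, 'k) monoid_scheme" and G :: "('g, 'm) monoid_scheme"
  assumes H: "group H" and fin: "finite (carrier H)" and a: "a \<in> carrier H" "a \<noteq> \<one>\<^bsub>H\<^esub>"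
    and G: "group G"
    and hom: "\<phi> \<in> hom (wreath_int H) G" and inj: "inj_on \<phi> (carrier (wreath_int H))"
  shows "lamp_group G (\<phi> (\<lambda>_. \<one>\<^bsub>H\<^esub>, 1)) (\<lambda>i. \<phi> (single_lamp H a i, 0))
           (\<lambda>n. (\<lambda>f. \<phi> (f, 0)) ` window_configs H n)"
proof -
  interpret H: group H by (rule H)
  interpret G: group G by (rule G)
  let ?W = "wreath_int H"
  let ?x = "\<phi> (\<lambda>_. \<one>\<^bsub>H\<^esub>, 1)"
  let ?l = "\<lambda>i. \<phi> (single_lamp H a i, 0)"
  let ?w = "\<lambda>n. (\<lambda>f. \<phi> (f, 0)) ` window_configs H n"
  note car = wreath_int_carrier[OF H]
  have closed: "\<phi> z \<in> carrier G" if "z \<in> carrier ?W" for z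
    using hom that by (auto simp: hom_def)
  have mult: "\<phi> (f, m) \<otimes>\<^bsub>G\<^esub> \<phi> (g, n) = \<phi> (\<lambda>i. f i \<otimes>\<^bsub>H\<^esub> g (i - m), m + n)"
    if "(f, m) \<in> carrier ?W" "(g, n) \<in> carrier ?W" for f g m n
    using hom_mult[OF hom that] by (simp add: wreath_int_mult)
  have eq_iff: "\<phi> y = \<phi> z \<longleftrightarrow> y = z" if "y \<in> carrier ?W" "z \<in> carrier ?W" for y z
    using inj that by (auto dest: inj_onD)
  have one_car: "(\<lambda>_. \<one>\<^bsub>H\<^esub>, m) \<in> carrier ?W" for m
    by (simp add: car)
  have win_car: "(f, m) \<in> carrier ?W" if "f \<in> window_configs H n" for f m n
    using that finite_support_window_configs[OF that] by (simp add: car window_configs_def)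
  have lamp_win: "single_lamp H a i \<in> window_configs H (nat \<bar>i\<bar>)" for i
    using a by (auto simp: single_lamp_def window_configs_def)
  have lamp_car: "(single_lamp H a i, m) \<in> carrier ?W" for i m
    by (rule win_car[OF lamp_win])
  have phi_one: "\<phi> (\<lambda>_. \<one>\<^bsub>H\<^esub>, 0) = \<one>\<^bsub>G\<^esub>"
  proof -
    have "\<phi> (\<lambda>_. \<one>\<^bsub>H\<^esub>, 0) \<otimes>\<^bsub>G\<^esub> \<phi> (\<lambda>_. \<one>\<^bsub>H\<^esub>, 0) = \<phi> (\<lambda>_. \<one>\<^bsub>H\<^esub>, 0)"
      using mult[OF one_car one_car, of 0 0] by simp
    then show ?thesis
      using closed[OF one_car] by (simp add: G.l_cancel_one)
  qed
  have x_pow: "?x [^]\<^bsub>G\<^esub> n = \<phi> (\<lambda>_. \<one>\<^bsub>H\<^esub>, int n)" for n :: nat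
  proof (induction n)
    case (Suc n)
    then show ?case
      using mult[OF one_car one_car, of "int n" 1] by (simp add: add.commute)
  qed (simp add: phi_one)
  have in_windows: "\<phi> (f, 0) \<in> (\<Union>n. ?w n)" if "(f, 0) \<in> carrier ?W" for f
    using in_some_window_configs[of f H] that by (auto simp: car)
  have shift_car: "((\<lambda>i. f (i + k)), m) \<in> carrier ?W" if "(f, m') \<in> carrier ?W" for f m m' k
  proof -
    have "finite ((\<lambda>i. i - k) ` {i. f i \<noteq> \<one>\<^bsub>H\<^esub>})"
      using that by (simp add: car)
    moreover have "{i. f (i + k) \<noteq> \<one>\<^bsub>H\<^esub>} \<subseteq> (\<lambda>i. i - k) ` {i. f i \<noteq> \<one>\<^bsub>H\<^esub>}"
      by (auto intro!: image_eqI[of _ _ "_ + k"])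
    ultimately have "finite {i. f (i + k) \<noteq> \<one>\<^bsub>H\<^esub>}"
      using finite_subset by blast
    then show ?thesis
      using that by (simp add: car)
  qed
  have x_move: "?x \<otimes>\<^bsub>G\<^esub> \<phi> (f, 0) = \<phi> (\<lambda>i. f (i - 1), 0) \<otimes>\<^bsub>G\<^esub> ?x"
    if f: "(f, 0) \<in> carrier ?W" for f
  proof -
    have s: "((\<lambda>i. f (i - 1)), 0) \<in> carrier ?W"
      using shift_car[OF f, of "-1" 0] by simp
    have fc: "f i \<in> carrier H" for i using f by (simp add: car)
    show ?thesis
      using mult[OF one_car f, of 1] mult[OF s one_car, of 1] fc by simp
  qed
  have not_window: "\<phi> (f, 0) \<notin> ?w n"
    if "(f, 0) \<in> carrier ?W" "\<bar>i\<bar> > int n" "f i \<noteq> \<one>\<^bsub>H\<^esub>" for f n i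
  proof
    assume "\<phi> (f, 0) \<in> ?w n"
    then obtain g where g: "g \<in> window_configs H n" "\<phi> (f, 0) = \<phi> (g, 0)" by blast
    then have "f = g"
      using eq_iff[OF that(1) win_car[OF g(1)]] by simp
    then show False
      using g(1) that by (simp add: window_configs_def)
  qed
  have ll: "?l i \<otimes>\<^bsub>G\<^esub> ?l j = \<phi> (\<lambda>k. single_lamp H a i k \<otimes>\<^bsub>H\<^esub> single_lamp H a j k, 0)" for i j
    using mult[OF lamp_car lamp_car, of i 0 j 0] by simp
  show ?thesis
  proof (intro lamp_group.intro lamp_group_axioms.intro)
    show "group G" by (rule G)
    show "?x \<in> carrier G" by (rule closed[OF one_car])
    show "?l i \<in> carrier G" for i by (rule closed[OF lamp_car])
    show "?x \<otimes>\<^bsub>G\<^esub> ?l i = ?l (i + 1) \<otimes>\<^bsub>G\<^esub> ?x" for i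
    proof -
      have "(\<lambda>j. single_lamp H a i (j - 1)) = single_lamp H a (i + 1)"
        by (auto simp: single_lamp_def fun_eq_iff)
      then show ?thesis
        using x_move[OF lamp_car, of i] by simp
    qed
    show "?l i \<otimes>\<^bsub>G\<^esub> ?l j = ?l j \<otimes>\<^bsub>G\<^esub> ?l i" for i j
    proof -
      have "(\<lambda>k. single_lamp H a i k \<otimes>\<^bsub>H\<^esub> single_lamp H a j k)
            = (\<lambda>k. single_lamp H a j k \<otimes>\<^bsub>H\<^esub> single_lamp H a i k)"
        using a by (auto simp: single_lamp_def fun_eq_iff)
      then show ?thesis by (simp add: ll)
    qed
    show "inj ?l"
    proof (rule injI)
      fix i j assume "?l i = ?l j"
      then have "single_lamp H a i = single_lamp H a j"
        using eq_iff[OF lamp_car lamp_car] by simp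
      then show "i = j"
        using a(2) fun_cong[of _ _ i] by (fastforce simp: single_lamp_def split: if_splits)
    qed
    show "subgroup (?w n) G" for n
    proof (rule G.subgroupI)
      show "?w n \<subseteq> carrier G"
        using closed[OF win_car] by blast
      show "?w n \<noteq> {}"
        by (auto simp: window_configs_def intro: exI[of _ "\<lambda>_. \<one>\<^bsub>H\<^esub>"])
      fix b assume "b \<in> ?w n"
      then obtain f where f: "f \<in> window_configs H n" "b = \<phi> (f, 0)" by blast
      have f': "(\<lambda>i. inv\<^bsub>H\<^esub> f i) \<in> window_configs H n"
        using f(1) by (auto simp: window_configs_def)
      have "\<phi> (\<lambda>i. inv\<^bsub>H\<^esub> f i, 0) \<otimes>\<^bsub>G\<^esub> b = \<one>\<^bsub>G\<^esub>"
        using mult[OF win_car[OF f'] win_car[OF f(1)], of 0 0] f phi_one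
        by (simp add: window_configs_def)
      then have "inv\<^bsub>G\<^esub> b = \<phi> (\<lambda>i. inv\<^bsub>H\<^esub> f i, 0)"
        using closed[OF win_car[OF f']] closed[OF win_car[OF f(1)]] f(2)
        by (intro G.inv_equality) auto
      then show "inv\<^bsub>G\<^esub> b \<in> ?w n"
        using f' by blast
      fix c assume "c \<in> ?w n"
      then obtain g where g: "g \<in> window_configs H n" "c = \<phi> (g, 0)" by blast
      have "(\<lambda>i. f i \<otimes>\<^bsub>H\<^esub> g i) \<in> window_configs H n"
        using f(1) g(1) by (auto simp: window_configs_def)
      then show "b \<otimes>\<^bsub>G\<^esub> c \<in> ?w n"
        using mult[OF win_car[OF f(1)] win_car[OF g(1)], of 0 0] f g by simp
    qed
    show "finite (?w n)" for n
      using finite_window_configs[OF fin] by blast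
    show "?w m \<subseteq> ?w n" if "m \<le> n" for m n
      using that by (intro image_mono) (auto simp: window_configs_def)
    show "?l i \<in> (\<Union>n. ?w n)" for i
      by (rule in_windows[OF lamp_car])
    fix b assume "b \<in> (\<Union>n. ?w n)"
    then obtain f n where f: "f \<in> window_configs H n" "b = \<phi> (f, 0)" by blast
    have fc: "(f, 0) \<in> carrier ?W" by (rule win_car[OF f(1)])
    have s: "((\<lambda>i. f (i - 1)), 0) \<in> carrier ?W" "((\<lambda>i. f (i + 1)), 0) \<in> carrier ?W"
      using shift_car[OF fc, of "-1" 0] shift_car[OF fc, of 1 0] by simp_all
    have xc: "?x \<in> carrier G" by (rule closed[OF one_car])
    have "?x \<otimes>\<^bsub>G\<^esub> b \<otimes>\<^bsub>G\<^esub> inv\<^bsub>G\<^esub> ?x = \<phi> (\<lambda>i. f (i - 1), 0)"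
      using x_move[OF fc] closed[OF s(1)] xc f(2) by (simp add: G.m_assoc)
    then show "?x \<otimes>\<^bsub>G\<^esub> b \<otimes>\<^bsub>G\<^esub> inv\<^bsub>G\<^esub> ?x \<in> (\<Union>n. ?w n)"
      using in_windows[OF s(1)] by simp
    have "b \<otimes>\<^bsub>G\<^esub> ?x = ?x \<otimes>\<^bsub>G\<^esub> \<phi> (\<lambda>i. f (i + 1), 0)"
      using x_move[OF s(2)] f(2) by simp
    then have "inv\<^bsub>G\<^esub> ?x \<otimes>\<^bsub>G\<^esub> b \<otimes>\<^bsub>G\<^esub> ?x = \<phi> (\<lambda>i. f (i + 1), 0)"
      using closed[OF s(2)] xc closed[OF fc] f(2) by (simp add: G.m_assoc G.inv_solve_left')
    then show "inv\<^bsub>G\<^esub> ?x \<otimes>\<^bsub>G\<^esub> b \<otimes>\<^bsub>G\<^esub> ?x \<in> (\<Union>n. ?w n)"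
      using in_windows[OF s(2)] by simp
  next
    fix n :: nat assume n: "n > 0"
    show "?x [^]\<^bsub>G\<^esub> n \<notin> (\<Union>n. ?w n)"
    proof
      assume "?x [^]\<^bsub>G\<^esub> n \<in> (\<Union>n. ?w n)"
      then obtain f k where f: "f \<in> window_configs H k" "?x [^]\<^bsub>G\<^esub> n = \<phi> (f, 0)" by blast
      then show False
        using n eq_iff[OF one_car win_car[OF f(1)]] by (simp add: x_pow)
    qed
  next
    fix n
    show "?l (int n + 1) \<notin> ?w n"
      by (rule not_window[OF lamp_car, of _ "int n + 1"]) (use a in \<open>auto simp: single_lamp_def\<close>)
    show "?l (- int n - 1) \<notin> ?w n"
      by (rule not_window[OF lamp_car, of _ "- int n - 1"]) (use a in \<open>auto simp: single_lamp_def\<close>)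
    have "(\<lambda>k. single_lamp H a (int n + 1) k \<otimes>\<^bsub>H\<^esub> single_lamp H a (- int n - 1) k)
          \<in> window_configs H (n + 1)"
      using a by (auto simp: window_configs_def single_lamp_def)
    then show "?l (int n + 1) \<otimes>\<^bsub>G\<^esub> ?l (- int n - 1) \<notin> ?w n"
      unfolding ll
      by (intro not_window[of _ _ "int n + 1"] win_car) (use a in \<open>auto simp: single_lamp_def\<close>)
  qed
qed

theorem theorem2:
  fixes H :: "('h, 'k) monoid_scheme" and G :: "('g, 'm) monoid_scheme" and K :: "'g set"
  assumes "group H" and "finite (carrier H)" and "carrier H \<noteq> {\<one>\<^bsub>H\<^esub>}"
    and "group G" and "subgroup K G" and "wreath_int H \<cong> G\<lparr>carrier := K\<rparr>"
  shows "\<not> flat_left_module (group_algebra G) (division_closure_module G) \<and>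
         \<not> flat_left_module (group_algebra G) (affiliated_module G)"
proof -
  obtain \<phi> where \<phi>: "\<phi> \<in> iso (wreath_int H) (G\<lparr>carrier := K\<rparr>)"
    using assms(6) by (auto simp: is_iso_def)
  have hom: "\<phi> \<in> hom (wreath_int H) G"
    using \<phi> subgroup.subset[OF assms(5)] by (auto simp: iso_def hom_def)
  have inj: "inj_on \<phi> (carrier (wreath_int H))"
    using \<phi> by (simp add: iso_def bij_betw_def)
  have "\<one>\<^bsub>H\<^esub> \<in> carrier H"
    using assms(1) by (simp add: group.is_monoid)
  then obtain a where a: "a \<in> carrier H" "a \<noteq> \<one>\<^bsub>H\<^esub>"
    using assms(3) by blast
  show ?thesis
    using lamp_group.not_flat[OF lamp_group_of_wreath_embedding[OF assms(1,2) a assms(4) hom inj]]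
    by blast
qed

end
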